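(* $(G_0(\mathbf{\Pi},\wedge),\odot,\Delta)$ is a bialgebra.
   Context: $\Bbbk$ is a field of characteristic zero. $\Pi_n$ is the set of set partitions of $[n]=\{1,\dots,n\}$ ($\Pi_0$ consists only of the empty set partition), ordered by $A\le B$ iff every part of $A$ is contained in a part of $B$. It is a lattice with meet $\wedge$, join $\vee$, maximal element $\mathbf{1}_n=\{[n]\}$, and Möbius function $\mu$. For $A\in\Pi_n$, $B\in\Pi_m$, the set partition $A|B\in\Pi_{n+m}$ consists of the parts of $A$ together with the parts of $B$ with every element shifted by $n$. $(\Bbbk\Pi_n,\wedge)$ is the $\Bbbk$-algebra with basis $\Pi_n$ and product extending $\wedge$ bilinearly (unit $\mathbf{1}_n$); it is commutative and semisimple, with primitive orthogonal idempotents $e_A=\sum_{B\le A}\mu(B,A)B$, and simple modules the one-dimensional spaces $V_A=\Bbbk\Pi_n\wedge e_A$, $A\in\Pi_n$. $G_0(\Bbbk\Pi_n,\wedge)$ is the Grothendieck group of the category of finite dimensional modules, regarded as the vector space spanned by the isomorphism classes of the simple modules $V_A$, $A\in\Pi_n$; $G_0(\mathbf{\Pi},\wedge)=\bigoplus_{n\ge0}G_0(\Bbbk\Pi_n,\wedge)$. The product $\odot$: for two finite dimensional $(\Bbbk\Pi_n,\wedge)$-modules $V,W$, $V\odot W$ is $V\otimes W$ with the diagonal action $C\cdot(v\otimes w)=Cv\otimes Cw$ for $C\in\Pi_n$; it is extended to $G_0(\mathbf{\Pi},\wedge)$ by setting $V_A\odot V_B=0$ if $V_A$ and $V_B$ are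 not of the same degree. The coproduct $\Delta$: let $\rho_{k,n-k}\colon\Bbbk\Pi_k\otimes\Bbbk\Pi_{n-k}\to\Bbbk\Pi_n$ be the injective multiplicative (non-unital) linear map $\rho_{k,n-k}(C\otimes D)=C|D$. For a finite dimensional $(\Bbbk\Pi_n,\wedge)$-module $V$, $\mathrm{Res}_{\rho_{k,n-k}}V=\{v\in V:\rho_{k,n-k}(\mathbf{1}_k\otimes\mathbf{1}_{n-k})v=v\}$, a $\Bbbk\Pi_k\otimes\Bbbk\Pi_{n-k}$-module via $\rho_{k,n-k}$, whose class lies in $G_0(\Bbbk\Pi_k,\wedge)\otimes G_0(\Bbbk\Pi_{n-k},\wedge)$. Then $\Delta(V)=\sum_{k=0}^n\mathrm{Res}_{\rho_{k,n-k}}V$ for $V\in G_0(\Bbbk\Pi_n,\wedge)$; on simple modules, $\Delta(V_A)=\sum_{A=B|C}V_B\otimes V_C$. The product $\odot$ on $G_0(\mathbf{\Pi},\wedge)\otimes G_0(\mathbf{\Pi},\wedge)$ is taken componentwise.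
   Formalization: The direct sum has no unit for the product, since different degrees multiply to zero; the unit axioms of a bialgebra are therefore stated for the formal infinite sum of the units of the degree components, degree by degree, while all other bialgebra axioms are stated in full. *)

theory Defs
  imports Complex_Main "HOL-Library.Poly_Mapping" "HOL-Library.Disjoint_Sets"
begin

section \<open>Free vector spaces\<close>

text \<open>
  The free \<open>'k\<close>-vector space on a type \<open>'a\<close> is \<open>'a \<Rightarrow>\<^sub>0 'k\<close>, and the one on a set
  \<open>B :: 'a set\<close> is \<open>free_on B\<close>.  The tensor product of \<open>free_on B\<close> and \<open>free_on C\<close> is
  \<open>free_on (B \<times> C)\<close>, with pure tensors \<open>tens x y\<close>.  The convolution product that
  \<open>Poly_Mapping\<close> puts on \<open>'a \<Rightarrow>\<^sub>0 'k\<close> is never used.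
\<close>

definition scl :: "'k::field \<Rightarrow> ('a \<Rightarrow>\<^sub>0 'k) \<Rightarrow> ('a \<Rightarrow>\<^sub>0 'k)" where
  "scl c x = Poly_Mapping.map ((*) c) x"

lemma lookup_scl [simp]: "Poly_Mapping.lookup (scl c x) a = c * Poly_Mapping.lookup x a"
  by (simp add: scl_def Poly_Mapping.map.rep_eq when_def)

interpretation pm: vector_space "scl :: 'k::field \<Rightarrow> ('a \<Rightarrow>\<^sub>0 'k) \<Rightarrow> ('a \<Rightarrow>\<^sub>0 'k)"
  by unfold_locales (auto intro!: poly_mapping_eqI simp: lookup_add algebra_simps)

abbreviation basis :: "'a \<Rightarrow> ('a \<Rightarrow>\<^sub>0 'k::field)" where
  "basis a \<equiv> Poly_Mapping.single a 1"

definition free_on :: "'a set \<Rightarrow> ('a \<Rightarrow>\<^sub>0 'k::field) set" where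
  "free_on B = {x. Poly_Mapping.keys x \<subseteq> B}"

definition linear_on :: "('a \<Rightarrow>\<^sub>0 'k::field) set \<Rightarrow> (('a \<Rightarrow>\<^sub>0 'k) \<Rightarrow> ('b \<Rightarrow>\<^sub>0 'k)) \<Rightarrow> bool" where
  "linear_on V f \<longleftrightarrow>
     (\<forall>x\<in>V. \<forall>y\<in>V. f (x + y) = f x + f y) \<and> (\<forall>c. \<forall>x\<in>V. f (scl c x) = scl c (f x))"

definition lin_form :: "('a \<Rightarrow> 'k::field) \<Rightarrow> ('a \<Rightarrow>\<^sub>0 'k) \<Rightarrow> 'k" where
  "lin_form e x = (\<Sum>a\<in>Poly_Mapping.keys x. Poly_Mapping.lookup x a * e a)"

definition lin_ext :: "('a \<Rightarrow> ('b \<Rightarrow>\<^sub>0 'k::field)) \<Rightarrow> ('a \<Rightarrow>\<^sub>0 'k) \<Rightarrow> ('b \<Rightarrow>\<^sub>0 'k)" where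
  "lin_ext f x = (\<Sum>a\<in>Poly_Mapping.keys x. scl (Poly_Mapping.lookup x a) (f a))"

definition bilin_ext ::
    "('a \<Rightarrow> 'b \<Rightarrow> ('c \<Rightarrow>\<^sub>0 'k::field)) \<Rightarrow> ('a \<Rightarrow>\<^sub>0 'k) \<Rightarrow> ('b \<Rightarrow>\<^sub>0 'k) \<Rightarrow> ('c \<Rightarrow>\<^sub>0 'k)" where
  "bilin_ext f x y = lin_ext (\<lambda>a. lin_ext (\<lambda>b. f a b) y) x"

definition tens :: "('a \<Rightarrow>\<^sub>0 'k::field) \<Rightarrow> ('b \<Rightarrow>\<^sub>0 'k) \<Rightarrow> ('a \<times> 'b \<Rightarrow>\<^sub>0 'k)" where
  "tens = bilin_ext (\<lambda>a b. basis (a, b))"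

text \<open>For \<open>f\<close>, \<open>g\<close> linear, \<open>map_tens f g\<close> is the linear map \<open>f \<otimes> g\<close>.\<close>

definition map_tens ::
    "(('a \<Rightarrow>\<^sub>0 'k::field) \<Rightarrow> ('c \<Rightarrow>\<^sub>0 'k)) \<Rightarrow> (('b \<Rightarrow>\<^sub>0 'k) \<Rightarrow> ('d \<Rightarrow>\<^sub>0 'k))
      \<Rightarrow> ('a \<times> 'b \<Rightarrow>\<^sub>0 'k) \<Rightarrow> ('c \<times> 'd \<Rightarrow>\<^sub>0 'k)" where
  "map_tens f g = lin_ext (\<lambda>(a, b). tens (f (basis a)) (g (basis b)))"

definition tens_assoc :: "(('a \<times> 'b) \<times> 'c \<Rightarrow>\<^sub>0 'k::field) \<Rightarrow> ('a \<times> 'b \<times> 'c \<Rightarrow>\<^sub>0 'k)" where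
  "tens_assoc = lin_ext (\<lambda>((a, b), c). basis (a, b, c))"

text \<open>Componentwise product on the tensor square:
  \<open>(a \<otimes> b) (c \<otimes> d) = m a c \<otimes> m b d\<close>.\<close>

definition tens_mult ::
    "(('a \<Rightarrow>\<^sub>0 'k::field) \<Rightarrow> ('a \<Rightarrow>\<^sub>0 'k) \<Rightarrow> ('a \<Rightarrow>\<^sub>0 'k))
      \<Rightarrow> ('a \<times> 'a \<Rightarrow>\<^sub>0 'k) \<Rightarrow> ('a \<times> 'a \<Rightarrow>\<^sub>0 'k) \<Rightarrow> ('a \<times> 'a \<Rightarrow>\<^sub>0 'k)" where
  "tens_mult m =
     bilin_ext (\<lambda>(a, b) (c, d). tens (m (basis a) (basis c)) (m (basis b) (basis d)))"


section \<open>Bialgebras\<close>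

definition assoc_algebra ::
    "'s set \<Rightarrow> (('s \<Rightarrow>\<^sub>0 'k::field) \<Rightarrow> ('s \<Rightarrow>\<^sub>0 'k) \<Rightarrow> ('s \<Rightarrow>\<^sub>0 'k)) \<Rightarrow> bool" where
  "assoc_algebra B m \<longleftrightarrow>
     (\<forall>x\<in>free_on B. \<forall>y\<in>free_on B. m x y \<in> free_on B) \<and>
     (\<forall>x\<in>free_on B. linear_on (free_on B) (m x)) \<and>
     (\<forall>y\<in>free_on B. linear_on (free_on B) (\<lambda>x. m x y)) \<and>
     (\<forall>x\<in>free_on B. \<forall>y\<in>free_on B. \<forall>z\<in>free_on B. m (m x y) z = m x (m y z))"

text \<open>A counit is a linear form; it is given by its values \<open>e\<close> on the basis \<open>B\<close>.\<close>

definition coassoc_coalgebra ::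
    "'s set \<Rightarrow> (('s \<Rightarrow>\<^sub>0 'k::field) \<Rightarrow> ('s \<times> 's \<Rightarrow>\<^sub>0 'k)) \<Rightarrow> ('s \<Rightarrow> 'k) \<Rightarrow> bool" where
  "coassoc_coalgebra B D e \<longleftrightarrow>
     (\<forall>x\<in>free_on B. D x \<in> free_on (B \<times> B)) \<and>
     linear_on (free_on B) D \<and>
     (\<forall>x\<in>free_on B. tens_assoc (map_tens D id (D x)) = map_tens id D (D x)) \<and>
     (\<forall>x\<in>free_on B. lin_ext (\<lambda>(a, b). scl (e a) (basis b)) (D x) = x) \<and>
     (\<forall>x\<in>free_on B. lin_ext (\<lambda>(a, b). scl (e b) (basis a)) (D x) = x)"

text \<open>
  Let \<open>G = free_on B\<close> be the direct sum of the components \<open>G\<^sub>n\<close> spanned by the basis elements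
  of degree \<open>n\<close>.  If the product is zero between different degrees and infinitely many \<open>G\<^sub>n\<close>
  are nonzero, \<open>G\<close> has no unit element: the unit can only be the formal sum of the units
  \<open>u n\<close> of the components, which lies in the direct product of the \<open>G\<^sub>n\<close>.  The predicate
  \<open>formal_unit\<close> says that \<open>\<Sum>\<^sub>n u n\<close> is a two-sided unit, and the last two clauses of
  \<open>bialgebra\<close> are the unit axioms \<open>\<Delta>(1) = 1 \<otimes> 1\<close> and \<open>\<epsilon>(1) = 1\<close>, read degree by degree.
\<close>

definition formal_unit ::
    "('s \<Rightarrow> nat) \<Rightarrow> 's set \<Rightarrow> (('s \<Rightarrow>\<^sub>0 'k::field) \<Rightarrow> ('s \<Rightarrow>\<^sub>0 'k) \<Rightarrow> ('s \<Rightarrow>\<^sub>0 'k))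
      \<Rightarrow> (nat \<Rightarrow> ('s \<Rightarrow>\<^sub>0 'k)) \<Rightarrow> bool" where
  "formal_unit deg B m u \<longleftrightarrow>
     (\<forall>n. u n \<in> free_on {b \<in> B. deg b = n}) \<and>
     (\<forall>n p. \<forall>x\<in>free_on {b \<in> B. deg b = n}.
        m (u p) x = (if p = n then x else 0) \<and> m x (u p) = (if p = n then x else 0))"

definition bialgebra ::
    "('s \<Rightarrow> nat) \<Rightarrow> 's set \<Rightarrow> (('s \<Rightarrow>\<^sub>0 'k::field) \<Rightarrow> ('s \<Rightarrow>\<^sub>0 'k) \<Rightarrow> ('s \<Rightarrow>\<^sub>0 'k))
      \<Rightarrow> (('s \<Rightarrow>\<^sub>0 'k) \<Rightarrow> ('s \<times> 's \<Rightarrow>\<^sub>0 'k)) \<Rightarrow> bool" where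
  "bialgebra deg B m D \<longleftrightarrow>
     assoc_algebra B m \<and>
     (\<forall>x\<in>free_on B. \<forall>y\<in>free_on B. D (m x y) = tens_mult m (D x) (D y)) \<and>
     (\<exists>e. coassoc_coalgebra B D e \<and>
        (\<forall>x\<in>free_on B. \<forall>y\<in>free_on B. lin_form e (m x y) = lin_form e x * lin_form e y) \<and>
        (\<exists>u. formal_unit deg B m u \<and>
           (\<forall>n. D (u n) = (\<Sum>k\<le>n. tens (u k) (u (n - k)))) \<and>
           (\<forall>n. lin_form e (u n) = (if n = 0 then 1 else 0))))"


section \<open>Set partitions\<close>

definition SP :: "nat \<Rightarrow> nat set set set" where
  "SP n = {A. partition_on {1..n} A}"

definition SP_all :: "nat set set set" where
  "SP_all = (\<Union>n. SP n)"

text \<open>A set partition determines the \<open>n\<close> for which it lies in \<open>SP n\<close>, so \<open>SP_all\<close> is the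
  disjoint union of the \<open>SP n\<close>.\<close>

definition sp_degree :: "nat set set \<Rightarrow> nat" where
  "sp_degree A = card (\<Union>A)"

abbreviation sp_le :: "nat \<Rightarrow> nat set set \<Rightarrow> nat set set \<Rightarrow> bool" where
  "sp_le n \<equiv> refines {1..n}"

definition sp_meet :: "nat set set \<Rightarrow> nat set set \<Rightarrow> nat set set" where
  "sp_meet A B = common_refinement {A, B}"

text \<open>The top element: for \<open>n = 0\<close> it is the empty partition, not \<open>{{}}\<close>.\<close>

definition sp_top :: "nat \<Rightarrow> nat set set" where
  "sp_top n = {{1..n}} - {{}}"

definition sp_bar :: "nat \<Rightarrow> nat set set \<Rightarrow> nat set set \<Rightarrow> nat set set" where
  "sp_bar n A B = A \<union> (\<lambda>b. (+) n ` b) ` B"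

function sp_mu :: "nat \<Rightarrow> nat set set \<Rightarrow> nat set set \<Rightarrow> int" where
  "sp_mu n B A =
     (if B = A then 1
      else if sp_le n B A
        then - (\<Sum>C | sp_le n B C \<and> sp_le n C A \<and> C \<noteq> A. sp_mu n B C)
      else 0)"
  by pat_completeness auto
termination
proof (relation "measure (\<lambda>(n, B, A). card {C. sp_le n B C \<and> sp_le n C A})")
  fix n B A C
  assume "sp_le n B A" and "C \<in> {C. sp_le n B C \<and> sp_le n C A \<and> C \<noteq> A}"
  then have C: "sp_le n B C" "sp_le n C A" "C \<noteq> A" and A: "sp_le n B A" "sp_le n A A"
    by (auto simp: refines_def)
  have "finite {E. sp_le n B E \<and> sp_le n E A}"
    by (rule finite_subset[OF _ finitely_many_partition_on[of "{1..n}"]]) (auto simp: refines_def)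
  moreover have "{E. sp_le n B E \<and> sp_le n E C} \<subset> {E. sp_le n B E \<and> sp_le n E A}"
  proof
    show "{E. sp_le n B E \<and> sp_le n E C} \<subseteq> {E. sp_le n B E \<and> sp_le n E A}"
      using C(2) refines_trans by blast
    have "\<not> sp_le n A C"
      using C refines_asym by blast
    then show "{E. sp_le n B E \<and> sp_le n E C} \<noteq> {E. sp_le n B E \<and> sp_le n E A}"
      using A by blast
  qed
  ultimately show "((n, B, C), (n, B, A)) \<in> measure (\<lambda>(n, B, A). card {C. sp_le n B C \<and> sp_le n C A})"
    by (simp add: psubset_card_mono)
qed simp

declare sp_mu.simps [simp del]


section \<open>The algebras and their modules\<close>

text \<open>The algebra of set partitions of \<open>[n]\<close> is \<open>free_on (SP n)\<close> with the product \<open>wedge\<close>.\<close>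

definition wedge ::
    "(nat set set \<Rightarrow>\<^sub>0 'k::field) \<Rightarrow> (nat set set \<Rightarrow>\<^sub>0 'k) \<Rightarrow> (nat set set \<Rightarrow>\<^sub>0 'k)" where
  "wedge = bilin_ext (\<lambda>A B. basis (sp_meet A B))"

definition sp_idem :: "nat \<Rightarrow> nat set set \<Rightarrow> (nat set set \<Rightarrow>\<^sub>0 'k::field)" where
  "sp_idem n A = (\<Sum>B | sp_le n B A. scl (of_int (sp_mu n B A)) (basis B))"

text \<open>
  A finite-dimensional module over an algebra with basis \<open>S :: 'a set\<close> is a pair \<open>(V, act)\<close>:
  the underlying space \<open>V\<close> is a subspace of a free vector space \<open>'i \<Rightarrow>\<^sub>0 'k\<close>, and \<open>act C\<close>,
  for \<open>C \<in> S\<close>, is the operator by which the basis element \<open>C\<close> acts.  These operators are taken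
  to be linear on all of \<open>'i \<Rightarrow>\<^sub>0 'k\<close> and to map \<open>V\<close> to itself (every linear operator on \<open>V\<close>
  extends to the ambient space), so that \<open>map_tens (act C) (act D)\<close> restricts to the tensor
  product of the operators on a tensor product of subspaces.
\<close>

type_synonym ('a, 'i, 'k) amodule =
  "('i \<Rightarrow>\<^sub>0 'k) set \<times> ('a \<Rightarrow> ('i \<Rightarrow>\<^sub>0 'k) \<Rightarrow> ('i \<Rightarrow>\<^sub>0 'k))"

definition simple_mod ::
    "nat \<Rightarrow> nat set set \<Rightarrow> (nat set set, nat set set, 'k::field) amodule" where
  "simple_mod n A = ({wedge x (sp_idem n A) | x. x \<in> free_on (SP n)}, \<lambda>C v. wedge (basis C) v)"

text \<open>The tensor product of two subspaces, inside the tensor product of their ambient spaces.\<close>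

definition tens_space ::
    "('i \<Rightarrow>\<^sub>0 'k::field) set \<Rightarrow> ('j \<Rightarrow>\<^sub>0 'k) set \<Rightarrow> ('i \<times> 'j \<Rightarrow>\<^sub>0 'k) set" where
  "tens_space V W = pm.span {tens v w | v w. v \<in> V \<and> w \<in> W}"

text \<open>The diagonal tensor product of two modules over the same algebra.\<close>

definition diag_tens_mod ::
    "('a, 'i, 'k::field) amodule \<Rightarrow> ('a, 'j, 'k) amodule \<Rightarrow> ('a, 'i \<times> 'j, 'k) amodule" where
  "diag_tens_mod M N =
     (tens_space (fst M) (fst N), \<lambda>C. map_tens (snd M C) (snd N C))"

text \<open>The external tensor product: a module over the tensor product of two algebras, whose
  basis consists of the pairs of basis elements.\<close>

definition ext_tens_mod ::
    "('a, 'i, 'k::field) amodule \<Rightarrow> ('b, 'j, 'k) amodule \<Rightarrow> ('a \<times> 'b, 'i \<times> 'j, 'k) amodule" where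
  "ext_tens_mod M N =
     (tens_space (fst M) (fst N), \<lambda>(C, D). map_tens (snd M C) (snd N D))"

text \<open>Restriction along \<open>C \<otimes> D \<mapsto> C|D\<close>, for \<open>C\<close> of degree \<open>k\<close> and \<open>D\<close> of degree \<open>l\<close>.\<close>

definition res_mod ::
    "nat \<Rightarrow> nat \<Rightarrow> (nat set set, 'i, 'k::field) amodule \<Rightarrow> (nat set set \<times> nat set set, 'i, 'k) amodule"
  where
  "res_mod k l M =
     ({v \<in> fst M. snd M (sp_bar k (sp_top k) (sp_top l)) v = v}, \<lambda>(C, D). snd M (sp_bar k C D))"


section \<open>Classes in the Grothendieck group\<close>

text \<open>
  Let \<open>simp s\<close>, \<open>s \<in> I\<close>, be representatives of the isomorphism classes of simple modules over
  an algebra with basis \<open>S\<close>.  The Grothendieck group, as a vector space, is \<open>free_on I\<close>, with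
  \<open>basis s\<close> the class of \<open>simp s\<close>; the class of a module is the sum of the classes of its
  composition factors.  \<open>has_class S I simp act V x\<close> says that the module \<open>(V, act)\<close> has a
  composition series with factors adding up to \<open>x\<close>: in the inductive step,
  \<open>0 \<rightarrow> U \<rightarrow> V \<rightarrow> simp s \<rightarrow> 0\<close> is a short exact sequence of modules with \<open>U\<close> a submodule of \<open>V\<close>.
\<close>

inductive has_class ::
    "'a set \<Rightarrow> 's set \<Rightarrow> ('s \<Rightarrow> ('a, 'j, 'k::field) amodule)
      \<Rightarrow> ('a \<Rightarrow> ('i \<Rightarrow>\<^sub>0 'k) \<Rightarrow> ('i \<Rightarrow>\<^sub>0 'k)) \<Rightarrow> ('i \<Rightarrow>\<^sub>0 'k) set \<Rightarrow> ('s \<Rightarrow>\<^sub>0 'k) \<Rightarrow> bool"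
  for S I simp act where
  zero: "has_class S I simp act {0} 0"
| step: "has_class S I simp act V (x + basis s)"
    if "has_class S I simp act U x"
      and "s \<in> I"
      and "pm.subspace V" and "\<forall>C\<in>S. \<forall>v\<in>V. act C v \<in> V"
      and "linear_on V g" and "\<forall>C\<in>S. \<forall>v\<in>V. g (act C v) = snd (simp s) C (g v)"
      and "g ` V = fst (simp s)" and "{v \<in> V. g v = 0} = U"

definition G0_class ::
    "'a set \<Rightarrow> 's set \<Rightarrow> ('s \<Rightarrow> ('a, 'j, 'k::field) amodule) \<Rightarrow> ('a, 'i, 'k) amodule \<Rightarrow> ('s \<Rightarrow>\<^sub>0 'k)" where
  "G0_class S I simp M = (THE x. has_class S I simp (snd M) (fst M) x)"

text \<open>
  The simple modules over the algebra of set partitions of \<open>[n]\<close> are the \<open>simple_mod n A\<close> with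
  \<open>A \<in> SP n\<close>, pairwise non-isomorphic, and those over the tensor product of two such algebras
  are their external tensor products.
\<close>

definition cls :: "nat \<Rightarrow> (nat set set, 'i, 'k::field) amodule \<Rightarrow> (nat set set \<Rightarrow>\<^sub>0 'k)" where
  "cls n = G0_class (SP n) (SP n) (simple_mod n)"

definition cls2 ::
    "nat \<Rightarrow> nat \<Rightarrow> (nat set set \<times> nat set set, 'i, 'k::field) amodule
      \<Rightarrow> (nat set set \<times> nat set set \<Rightarrow>\<^sub>0 'k)" where
  "cls2 k l =
     G0_class (SP k \<times> SP l) (SP k \<times> SP l) (\<lambda>(B, C). ext_tens_mod (simple_mod k B) (simple_mod l C))"


section \<open>Product and coproduct\<close>

text \<open>The underlying space of both is \<open>free_on SP_all\<close>, the direct sum over all \<open>n\<close>.\<close>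

definition G0_prod ::
    "(nat set set \<Rightarrow>\<^sub>0 'k::field) \<Rightarrow> (nat set set \<Rightarrow>\<^sub>0 'k) \<Rightarrow> (nat set set \<Rightarrow>\<^sub>0 'k)" where
  "G0_prod = bilin_ext (\<lambda>A B.
     let n = sp_degree A in
       if sp_degree B = n then cls n (diag_tens_mod (simple_mod n A) (simple_mod n B)) else 0)"

definition G0_coprod ::
    "(nat set set \<Rightarrow>\<^sub>0 'k::field) \<Rightarrow> (nat set set \<times> nat set set \<Rightarrow>\<^sub>0 'k)" where
  "G0_coprod = lin_ext (\<lambda>A.
     let n = sp_degree A in
       \<Sum>k\<le>n. cls2 k (n - k) (res_mod k (n - k) (simple_mod n A)))"

end

theory Submission
  imports Defs
begin

text \<open>
  By Moebius inversion \<open>C \<and> e\<^sub>A\<close> is \<open>e\<^sub>A\<close> if \<open>A \<le> C\<close> and \<open>0\<close> otherwise, so each simple module is a line with the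
  character \<open>C \<mapsto> [A \<le> C]\<close>, and a module which is a line is identified in the Grothendieck group by its
  character.  Hence \<open>V\<^sub>A \<odot> V\<^sub>B = V\<^bsub>A \<or> B\<^esub>\<close> and \<open>\<Delta>(V\<^sub>A)\<close> is the sum of \<open>V\<^sub>B \<otimes> V\<^sub>C\<close> over the cuts \<open>A = B|C\<close>.
  Coassociativity is the associativity of \<open>|\<close>.  Compatibility rests on two facts:
  \<open>(A|B) \<or> (A'|B') = (A \<or> A')|(B \<or> B')\<close>, and the partitions of the form \<open>B|C\<close> with \<open>B\<close> of degree \<open>k\<close>
  are those below \<open>1\<^sub>k|1\<^sub>l\<close>, so that every cut of \<open>A \<or> B\<close> comes from cuts of \<open>A\<close> and of \<open>B\<close> at the same
  place.  The unit consists of the partitions into singletons, and the counit detects degree \<open>0\<close>.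
\<close>

section \<open>Linear algebra of free vector spaces\<close>

text \<open>Points outside the support contribute zero. A common finite index set is what makes
  additivity provable, because the supports of \<open>x\<close>, \<open>y\<close> and
  \<open>x + y\<close> differ.\<close>

lemma lin_ext_superset:
  assumes "finite S" "Poly_Mapping.keys x \<subseteq> S"
  shows "lin_ext f x = (\<Sum>a\<in>S. scl (Poly_Mapping.lookup x a) (f a))"
  unfolding lin_ext_def
  by (rule sum.mono_neutral_left) (use assms in \<open>auto simp: in_keys_iff\<close>)

lemma lin_ext_zero [simp]: "lin_ext f 0 = 0"
  by (simp add: lin_ext_def)

lemma lin_ext_add: "lin_ext f (x + y) = lin_ext f x + lin_ext f y"
proof -
  let ?S = "Poly_Mapping.keys x \<union> Poly_Mapping.keys y"
  have "Poly_Mapping.keys (x + y) \<subseteq> ?S"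
    by (rule Poly_Mapping.keys_add)
  then show ?thesis
    by (simp add: lin_ext_superset[of ?S] lookup_add pm.scale_left_distrib sum.distrib)
qed

lemma lin_ext_scl: "lin_ext f (scl c x) = scl c (lin_ext f x)"
proof -
  have "Poly_Mapping.keys (scl c x) \<subseteq> Poly_Mapping.keys x"
    by (auto simp: in_keys_iff)
  then show ?thesis
    by (simp add: lin_ext_superset[of "Poly_Mapping.keys x"] pm.scale_sum_right)
qed

lemma lin_ext_basis [simp]: "lin_ext f (basis a) = f a"
  by (simp add: lin_ext_def)

lemma lin_ext_sum: "lin_ext f (\<Sum>i\<in>I. g i) = (\<Sum>i\<in>I. lin_ext f (g i))"
  by (induction I rule: infinite_finite_induct) (auto simp: lin_ext_add)

lemma linear_on_zero: "linear_on UNIV f \<Longrightarrow> f 0 = 0"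
  by (metis UNIV_I linear_on_def pm.scale_zero_left)

lemma linear_on_sum:
  assumes "linear_on UNIV f"
  shows "f (\<Sum>i\<in>I. g i) = (\<Sum>i\<in>I. f (g i))"
  using assms linear_on_zero[OF assms]
  by (induction I rule: infinite_finite_induct) (auto simp: linear_on_def)

lemma lin_ext_plus_fun: "lin_ext (\<lambda>a. f a + g a) x = lin_ext f x + lin_ext g x"
  by (simp add: lin_ext_def pm.scale_right_distrib sum.distrib)

lemma lin_ext_scl_fun: "lin_ext (\<lambda>a. scl c (f a)) x = scl c (lin_ext f x)"
  by (simp add: lin_ext_def pm.scale_sum_right mult.commute)

lemma lin_ext_zero_fun [simp]: "lin_ext (\<lambda>a. 0) x = 0"
  by (simp add: lin_ext_def)

lemma bilin_ext_basis [simp]: "bilin_ext f (basis a) (basis b) = f a b"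
  by (simp add: bilin_ext_def)

lemma bilin_ext_simps:
  "bilin_ext f 0 y = 0" "bilin_ext f x 0 = 0"
  "bilin_ext f (x + x') y = bilin_ext f x y + bilin_ext f x' y"
  "bilin_ext f x (y + y') = bilin_ext f x y + bilin_ext f x y'"
  "bilin_ext f (scl c x) y = scl c (bilin_ext f x y)"
  "bilin_ext f x (scl c y) = scl c (bilin_ext f x y)"
  by (simp_all add: bilin_ext_def lin_ext_add lin_ext_scl lin_ext_plus_fun lin_ext_scl_fun)

lemma linear_bilin_ext:
  "linear_on UNIV (bilin_ext f x)" "linear_on UNIV (\<lambda>x. bilin_ext f x y)"
  by (simp_all add: linear_on_def bilin_ext_simps)

lemma bilin_ext_sum:
  "bilin_ext f (\<Sum>i\<in>I. g i) (\<Sum>j\<in>J. h j) = (\<Sum>i\<in>I. \<Sum>j\<in>J. bilin_ext f (g i) (h j))"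
  unfolding linear_on_sum[OF linear_bilin_ext(1)] linear_on_sum[OF linear_bilin_ext(2)]
  by (rule sum.swap)

lemma lin_form_superset:
  assumes "finite S" "Poly_Mapping.keys x \<subseteq> S"
  shows "lin_form e x = (\<Sum>a\<in>S. Poly_Mapping.lookup x a * e a)"
  unfolding lin_form_def
  by (rule sum.mono_neutral_left) (use assms in \<open>auto simp: in_keys_iff\<close>)

lemma lin_form_simps [simp]:
  "lin_form e 0 = 0"
  "lin_form e (basis a) = e a"
  "lin_form e (x + y) = lin_form e x + lin_form e y"
  "lin_form e (scl c x) = c * lin_form e x"
proof -
  let ?S = "Poly_Mapping.keys x \<union> Poly_Mapping.keys y"
  have "Poly_Mapping.keys (x + y) \<subseteq> ?S"
    by (rule Poly_Mapping.keys_add)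
  then show "lin_form e (x + y) = lin_form e x + lin_form e y"
    by (simp add: lin_form_superset[of ?S] lookup_add algebra_simps sum.distrib)
  have "Poly_Mapping.keys (scl c x) \<subseteq> Poly_Mapping.keys x"
    by (auto simp: in_keys_iff)
  then show "lin_form e (scl c x) = c * lin_form e x"
    by (simp add: lin_form_superset[of "Poly_Mapping.keys x"] sum_distrib_left mult.assoc)
qed (simp_all add: lin_form_def)

lemma poly_mapping_expand_basis: "x = (\<Sum>a\<in>Poly_Mapping.keys x. scl (Poly_Mapping.lookup x a) (basis a))"
  by (rule poly_mapping_eqI)
     (auto simp: lookup_sum lookup_single when_def in_keys_iff if_distrib[of "(*) _"] cong: if_cong)

text \<open>Every element is a finite combination of basis elements from its support. Each
  multilinear identity below is reduced to basis elements by this rule, one argument at a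
  time.\<close>

lemma free_on_induct [consumes 1, case_names zero add scl basis]:
  assumes "x \<in> free_on B"
    and "P 0"
    and "\<And>x y. P x \<Longrightarrow> P y \<Longrightarrow> P (x + y)"
    and "\<And>c x. P x \<Longrightarrow> P (scl c x)"
    and "\<And>b. b \<in> B \<Longrightarrow> P (basis b)"
  shows "P x"
proof -
  have "P (\<Sum>a\<in>K. scl (c a) (basis a))" if "finite K" "K \<subseteq> B" for K c
    using that by (induction K) (use assms in auto)
  from this[of "Poly_Mapping.keys x" "Poly_Mapping.lookup x"] show ?thesis
    using assms(1) poly_mapping_expand_basis[of x] by (simp add: free_on_def)
qed

lemma free_on_intros [intro]:
  "0 \<in> free_on B"
  "x \<in> free_on B \<Longrightarrow> y \<in> free_on B \<Longrightarrow> x + y \<in> free_on B"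
  "x \<in> free_on B \<Longrightarrow> scl c x \<in> free_on B"
  "b \<in> B \<Longrightarrow> basis b \<in> free_on B"
  using Poly_Mapping.keys_add[of x y] by (auto simp: free_on_def in_keys_iff lookup_add)

lemma free_on_sum: "(\<And>i. i \<in> I \<Longrightarrow> f i \<in> free_on B) \<Longrightarrow> (\<Sum>i\<in>I. f i) \<in> free_on B"
  by (induction I rule: infinite_finite_induct) auto

section \<open>Tensor products of vectors, of maps and of lines\<close>

lemma tens_simps:
  "tens 0 y = 0" "tens x 0 = 0"
  "tens (x + x') y = tens x y + tens x' y"
  "tens x (y + y') = tens x y + tens x y'"
  "tens (scl c x) y = scl c (tens x y)"
  "tens x (scl c y) = scl c (tens x y)"
  by (simp_all add: tens_def bilin_ext_simps)

lemma tens_basis [simp]: "tens (basis a) (basis b) = basis (a, b)"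
  by (simp add: tens_def)

text \<open>Both sides are bilinear, so basis vectors suffice. The formula serves to show that pure
  tensors of nonzero vectors are nonzero, since a field has no zero divisors.\<close>

lemma lookup_tens:
  "Poly_Mapping.lookup (tens x y) (a, b) = Poly_Mapping.lookup x a * Poly_Mapping.lookup y b"
proof -
  have "y \<in> free_on UNIV"
    by (simp add: free_on_def)
  then have *: "Poly_Mapping.lookup (tens (basis c) y) (a, b) = (1 when c = a) * Poly_Mapping.lookup y b" for c
    by (induction y rule: free_on_induct)
       (auto simp: tens_simps lookup_add lookup_single when_def algebra_simps)
  have "x \<in> free_on UNIV"
    by (simp add: free_on_def)
  then show ?thesis
    by (induction x rule: free_on_induct)
       (auto simp: tens_simps lookup_add algebra_simps lookup_single *)
qed

lemma tens_eq_0_iff [simp]: "tens x y = 0 \<longleftrightarrow> x = 0 \<or> y = 0"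
proof
  assume "tens x y = 0"
  then have "Poly_Mapping.lookup x a * Poly_Mapping.lookup y b = 0" for a b
    by (metis lookup_tens lookup_zero)
  then show "x = 0 \<or> y = 0"
    by (metis mult_eq_0_iff poly_mapping_eqI lookup_zero)
qed (auto simp: tens_simps)

lemma map_tens_simps:
  "map_tens f g 0 = 0"
  "map_tens f g (x + y) = map_tens f g x + map_tens f g y"
  "map_tens f g (scl c x) = scl c (map_tens f g x)"
  by (simp_all add: map_tens_def lin_ext_add lin_ext_scl)

text \<open>\<open>map_tens\<close> only sees the values of \<open>f\<close> and \<open>g\<close> on
  basis vectors. Linearity on the whole ambient space extends the formula to arbitrary pure
  tensors.\<close>

lemma map_tens_tens:
  assumes f: "linear_on UNIV f" and g: "linear_on UNIV g"
  shows "map_tens f g (tens x y) = tens (f x) (g y)"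
proof -
  have [simp]: "map_tens f g (basis (a, b)) = tens (f (basis a)) (g (basis b))" for a b
    by (simp add: map_tens_def)
  note [simp] = tens_simps map_tens_simps linear_on_zero[OF f] linear_on_zero[OF g]
    f[unfolded linear_on_def, simplified] g[unfolded linear_on_def, simplified]
  have "y \<in> free_on UNIV"
    by (simp add: free_on_def)
  then have *: "map_tens f g (tens (basis a) y) = tens (f (basis a)) (g y)" for a
    by (induction y rule: free_on_induct) simp_all
  have "x \<in> free_on UNIV"
    by (simp add: free_on_def)
  then show ?thesis
    by (induction x rule: free_on_induct) (simp_all add: *)
qed

lemma subspace_line: "pm.subspace (range (\<lambda>c. scl c v))"
  by (metis pm.span_singleton pm.subspace_span)

lemma tens_space_lines:
  "tens_space (range (\<lambda>c. scl c v)) (range (\<lambda>c. scl c w)) = range (\<lambda>c. scl c (tens v w))"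
    (is "?L = ?R")
proof
  have "tens (scl c v) (scl d w) \<in> ?R" for c d
    by (intro range_eqI[of _ _ "c * d"]) (simp add: tens_simps mult.commute)
  then show "?L \<subseteq> ?R"
    unfolding tens_space_def by (intro pm.span_minimal subspace_line) auto
  show "?R \<subseteq> ?L"
  proof
    fix x assume "x \<in> ?R"
    then obtain c where "x = tens (scl c v) (scl 1 w)"
      by (auto simp: tens_simps)
    then show "x \<in> ?L"
      unfolding tens_space_def by (intro pm.span_base) blast
  qed
qed


section \<open>Modules that are lines\<close>

text \<open>A one-dimensional module on which \<open>S\<close> acts through the character
  \<open>\<chi>\<close>. Together with the zero module, these are the only modules whose classes
  have to be computed.\<close>

definition line_module ::
    "'a set \<Rightarrow> ('a \<Rightarrow> 'k::field) \<Rightarrow> ('a, 'i, 'k) amodule \<Rightarrow> bool" where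
  "line_module S \<chi> M \<longleftrightarrow>
     (\<exists>v. v \<noteq> 0 \<and> fst M = range (\<lambda>c. scl c v) \<and> (\<forall>C\<in>S. \<forall>x\<in>fst M. snd M C x = scl (\<chi> C) x))"

text \<open>A last composition factor would be the image of the zero space, but the simple modules
  are lines; so only the empty composition series remains.\<close>

lemma has_class_trivial:
  assumes "has_class S I simp act V x" and "V = {0}"
    and "\<forall>s\<in>I. line_module S (\<chi> s) (simp s)"
  shows "x = 0"
  using assms(1)
proof cases
  case (step U y s g)
  from assms(3) \<open>s \<in> I\<close> obtain w where w: "w \<noteq> 0" "fst (simp s) = range (\<lambda>c. scl c w)"
    by (auto simp: line_module_def)
  \<comment> \<open>Linearity on \<open>V\<close> gives \<open>g 0 = 0\<close> by scaling the vector
    \<open>0\<close> with the scalar \<open>0\<close>.\<close>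
  have "g (scl 0 0) = scl 0 (g 0)"
    using step(6) assms(2) unfolding linear_on_def by blast
  then have "fst (simp s) = {0}"
    using step(8) assms(2) by simp
  moreover have "scl 1 w \<in> fst (simp s)"
    unfolding w(2) by blast
  ultimately show ?thesis
    using w by simp
qed simp

text \<open>Existence: sending generator to generator is an isomorphism onto \<open>simp s\<close>
  with zero kernel. Uniqueness: a surjection from a line onto a line is injective, so the series has
  a single factor, and that factor has the same character as \<open>M\<close>.\<close>

lemma has_class_line:
  assumes simp: "\<forall>s\<in>I. line_module S (\<chi> s) (simp s)"
    and inj: "\<forall>s\<in>I. \<forall>t\<in>I. (\<forall>C\<in>S. \<chi> s C = \<chi> t C) \<longrightarrow> s = t"
    and M: "line_module S (\<chi> s) M" and s: "s \<in> I"
  shows "has_class S I simp (snd M) (fst M) x \<longleftrightarrow> x = basis s"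
proof -
  obtain v where v: "v \<noteq> 0" "fst M = range (\<lambda>c. scl c v)"
    and act: "\<And>C x. C \<in> S \<Longrightarrow> x \<in> fst M \<Longrightarrow> snd M C x = scl (\<chi> s C) x"
    using M by (auto simp: line_module_def)
  have vM: "scl c v \<in> fst M" for c
    by (auto simp: v)
  have vM1: "v \<in> fst M"
    using vM[of 1] by simp
  have *: "has_class S I simp (snd M) (fst M) (0 + basis s)"
  proof -
    obtain w where w: "w \<noteq> 0" "fst (simp s) = range (\<lambda>c. scl c w)"
      and w_act: "\<And>C x. C \<in> S \<Longrightarrow> x \<in> fst (simp s) \<Longrightarrow> snd (simp s) C x = scl (\<chi> s C) x"
      using simp s by (auto simp: line_module_def)
    \<comment> \<open>A coordinate in which \<open>v\<close> does not vanish recovers the scalar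
      \<open>c\<close> from \<open>scl c v\<close>, so the isomorphism \<open>g\<close> can be given
      by a formula.\<close>
    obtain a where a: "Poly_Mapping.lookup v a \<noteq> 0"
      using v(1) by (metis lookup_zero poly_mapping_eqI)
    define g where "g y = scl (Poly_Mapping.lookup y a / Poly_Mapping.lookup v a) w" for y
    have g: "g (scl c v) = scl c w" for c
      using a by (simp add: g_def)
    show ?thesis
    proof (rule has_class.step[where U = "{0}" and g = g])
      show "pm.subspace (fst M)"
        unfolding v by (rule subspace_line)
      show "linear_on (fst M) g"
        by (auto simp: linear_on_def g_def lookup_add add_divide_distrib pm.scale_left_distrib)
      show "\<forall>C\<in>S. \<forall>y\<in>fst M. snd M C y \<in> fst M"
        by (auto simp: act) (auto simp: v)
      show "\<forall>C\<in>S. \<forall>y\<in>fst M. g (snd M C y) = snd (simp s) C (g y)"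
      proof (intro ballI)
        fix C y assume C: "C \<in> S" and y: "y \<in> fst M"
        have "g y \<in> fst (simp s)"
          by (auto simp: g_def w)
        with act[OF C y] w_act[OF C] show "g (snd M C y) = snd (simp s) C (g y)"
          by (simp add: g_def)
      qed
      show "g ` fst M = fst (simp s)"
        by (simp add: v w image_image g)
      show "{y \<in> fst M. g y = 0} = {0}"
        using w(1) by (auto simp: v g image_iff intro: exI[of _ 0])
          (metis g pm.scale_zero_left)
    qed (use s in \<open>auto intro: has_class.zero\<close>)
  qed
  have "x = basis s" if "has_class S I simp (snd M) (fst M) x"
    using that
  proof cases
    case zero
    then show ?thesis
      using v vM1 by auto
  next
    case (step U y t g)
    obtain w where w: "w \<noteq> 0" "fst (simp t) = range (\<lambda>c. scl c w)"
      and w_act: "\<And>C x. C \<in> S \<Longrightarrow> x \<in> fst (simp t) \<Longrightarrow> snd (simp t) C x = scl (\<chi> t C) x"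
      using simp step(3) by (auto simp: line_module_def)
    have g_scl: "g (scl c v) = scl c (g v)" for c
      using step(6) vM1 by (auto simp: linear_on_def)
    \<comment> \<open>Surjectivity onto a nonzero line forces \<open>g v\<close> to be nonzero,
      hence the kernel \<open>U\<close> is zero.\<close>
    have "scl 1 w \<in> g ` fst M"
      unfolding step(8) w(2) by blast
    then have gv: "g v \<noteq> 0"
      using w(1) by (auto simp: v g_scl)
    then have "U = {0}"
      using step(9) v by (auto simp: g_scl image_iff intro: exI[of _ 0])
        (metis g_scl pm.scale_zero_left)
    with step(2) have "y = 0"
      using has_class_trivial simp by blast
    moreover have "s = t"
    \<comment> \<open>Evaluating the action on \<open>g v\<close> before and after applying
      \<open>g\<close> shows that the two characters agree on \<open>S\<close>.\<close>
    proof (rule inj[THEN bspec, THEN bspec, THEN mp, OF s step(3)], intro ballI)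
      fix C assume C: "C \<in> S"
      have gvt: "g v \<in> fst (simp t)"
        using step(8) vM1 by blast
      have "scl (\<chi> s C) (g v) = g (snd M C v)"
        by (simp add: act[OF C vM1] g_scl)
      also have "\<dots> = scl (\<chi> t C) (g v)"
        using step(7) C vM1 w_act[OF C gvt] by simp
      finally show "\<chi> s C = \<chi> t C"
        using gv by simp
    qed
    ultimately show ?thesis
      using step(1) by simp
  qed
  then show ?thesis
    using * by auto
qed

lemma G0_class_line:
  assumes "\<forall>s\<in>I. line_module S (\<chi> s) (simp s)"
    and "\<forall>s\<in>I. \<forall>t\<in>I. (\<forall>C\<in>S. \<chi> s C = \<chi> t C) \<longrightarrow> s = t"
    and "line_module S (\<chi> s) M" and "s \<in> I"
  shows "G0_class S I simp M = basis s"
  unfolding G0_class_def by (rule the_equality) (simp_all add: has_class_line[where \<chi> = \<chi>, OF assms])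

lemma G0_class_trivial:
  assumes "\<forall>s\<in>I. line_module S (\<chi> s) (simp s)" and "fst M = {0}"
  shows "G0_class S I simp M = 0"
  unfolding G0_class_def
  using has_class_trivial[OF _ assms(2) assms(1)] assms(2)
  by (intro the_equality) (auto intro: has_class.zero)

lemma line_moduleE:
  assumes "line_module S \<chi> M"
  obtains v where "v \<noteq> 0" "fst M = range (\<lambda>c. scl c v)" "v \<in> fst M"
    "\<And>C x. C \<in> S \<Longrightarrow> x \<in> fst M \<Longrightarrow> snd M C x = scl (\<chi> C) x"
proof -
  obtain v where v: "v \<noteq> 0" "fst M = range (\<lambda>c. scl c v)"
    "\<And>C x. C \<in> S \<Longrightarrow> x \<in> fst M \<Longrightarrow> snd M C x = scl (\<chi> C) x"
    using assms by (auto simp: line_module_def)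
  moreover have "scl 1 v \<in> fst M"
    unfolding v(2) by blast
  ultimately show ?thesis
    using that by simp
qed

lemma line_module_cong:
  "line_module S \<chi> M \<Longrightarrow> (\<And>C. C \<in> S \<Longrightarrow> \<chi> C = \<psi> C) \<Longrightarrow> line_module S \<psi> M"
  by (simp add: line_module_def)

text \<open>The tensor product of the two generators generates the product line, and the scalars of
  the two actions multiply.\<close>

lemma line_module_ext_tens:
  assumes M: "line_module S \<chi> M" and N: "line_module T \<psi> N"
    and "\<And>C. C \<in> S \<Longrightarrow> linear_on UNIV (snd M C)" "\<And>D. D \<in> T \<Longrightarrow> linear_on UNIV (snd N D)"
  shows "line_module (S \<times> T) (\<lambda>(C, D). \<chi> C * \<psi> D) (ext_tens_mod M N)"
proof -
  obtain v where v: "v \<noteq> 0" "fst M = range (\<lambda>c. scl c v)" "v \<in> fst M"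
    "\<And>C x. C \<in> S \<Longrightarrow> x \<in> fst M \<Longrightarrow> snd M C x = scl (\<chi> C) x"
    using M by (rule line_moduleE) blast
  obtain w where w: "w \<noteq> 0" "fst N = range (\<lambda>c. scl c w)" "w \<in> fst N"
    "\<And>C x. C \<in> T \<Longrightarrow> x \<in> fst N \<Longrightarrow> snd N C x = scl (\<psi> C) x"
    using N by (rule line_moduleE) blast
  show ?thesis
    unfolding line_module_def
  proof (intro exI[of _ "tens v w"] conjI ballI)
    show fst: "fst (ext_tens_mod M N) = range (\<lambda>c. scl c (tens v w))"
      by (simp add: ext_tens_mod_def v(2) w(2) tens_space_lines)
    fix E x assume "E \<in> S \<times> T" "x \<in> fst (ext_tens_mod M N)"
    then obtain C D c where "C \<in> S" "D \<in> T" "E = (C, D)" "x = scl c (tens v w)"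
      unfolding fst by blast
    then show "snd (ext_tens_mod M N) E x = scl (case E of (C, D) \<Rightarrow> \<chi> C * \<psi> D) x"
      using assms(3,4) v(3,4) w(3,4)
      by (simp add: ext_tens_mod_def map_tens_simps map_tens_tens tens_simps mult_ac)
  qed (use v w in simp)
qed

text \<open>The diagonal action is the external one restricted to the pairs \<open>(C, C)\<close>,
  on the same underlying space.\<close>

lemma line_module_diag_tens:
  assumes "line_module S \<chi> M" "line_module S \<psi> N"
    and "\<And>C. C \<in> S \<Longrightarrow> linear_on UNIV (snd M C)" "\<And>D. D \<in> S \<Longrightarrow> linear_on UNIV (snd N D)"
  shows "line_module S (\<lambda>C. \<chi> C * \<psi> C) (diag_tens_mod M N)"
proof -
  obtain v where "v \<noteq> 0" "fst (ext_tens_mod M N) = range (\<lambda>c. scl c v)"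
    "\<forall>E\<in>S \<times> S. \<forall>x\<in>fst (ext_tens_mod M N).
       snd (ext_tens_mod M N) E x = scl (case E of (C, D) \<Rightarrow> \<chi> C * \<psi> D) x"
    using line_module_ext_tens[OF assms] unfolding line_module_def by blast
  then show ?thesis
    unfolding line_module_def
    by (intro exI[of _ v]) (auto simp: ext_tens_mod_def diag_tens_mod_def)
qed


section \<open>The lattice of set partitions\<close>

declare One_nat_def [simp del]

lemma finite_SP [simp]: "finite (SP n)"
  unfolding SP_def by (rule finitely_many_partition_on) simp

lemma sp_le_SP: "sp_le n A B \<Longrightarrow> A \<in> SP n \<and> B \<in> SP n"
  by (simp add: refines_def SP_def)

lemma sp_le_refl: "A \<in> SP n \<Longrightarrow> sp_le n A A"
  by (simp add: SP_def refines_refl)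

lemma finite_sp_le [simp]: "finite {B. sp_le n B A}" "finite {B. sp_le n B A \<and> P B}"
  "finite {B. P B \<and> sp_le n B A}"
  by (auto intro: finite_subset[OF _ finite_SP[of n]] dest: sp_le_SP)

lemma sp_degree_SP [simp]: "A \<in> SP n \<Longrightarrow> sp_degree A = n"
  by (simp add: SP_def sp_degree_def partition_onD1[symmetric])

lemma SP_all_iff: "A \<in> SP_all \<longleftrightarrow> A \<in> SP (sp_degree A)"
  by (auto simp: SP_all_def)

lemma SP_0 [simp]: "SP 0 = {{}}"
  by (simp add: SP_def partition_on_empty)

lemma sp_top_SP [simp]: "sp_top n \<in> SP n"
  by (cases "n = 0") (auto simp: SP_def sp_top_def partition_on_empty intro!: partition_on_space)

lemma sp_le_top: "sp_le n A (sp_top n)" if "A \<in> SP n"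
  unfolding refines_def
proof (intro conjI ballI)
  fix X assume "X \<in> A"
  \<comment> \<open>Having a nonempty part makes \<open>{1..n}\<close> nonempty, so it survives the
    removal of the empty set in \<open>sp_top\<close>.\<close>
  with that have "X \<subseteq> {1..n}" "X \<noteq> {}"
    by (auto simp: SP_def partition_on_def)
  then show "\<exists>Y\<in>sp_top n. X \<subseteq> Y"
    by (auto simp: sp_top_def)
qed (use that sp_top_SP in \<open>auto simp: SP_def simp del: sp_top_SP\<close>)

lemma sp_meet_SP:
  assumes "A \<in> SP n" "B \<in> SP n"
  shows "sp_meet A B \<in> SP n"
  unfolding SP_def sp_meet_def using assms
  by (auto intro!: partition_on_common_refinement simp: SP_def)

lemma sp_le_meet_iff:
  assumes "A \<in> SP n" "B \<in> SP n"
  shows "sp_le n D (sp_meet A B) \<longleftrightarrow> sp_le n D A \<and> sp_le n D B"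
proof
  have P: "\<And>P. P \<in> {A, B} \<Longrightarrow> partition_on {1..n} P"
    using assms by (auto simp: SP_def)
  show "sp_le n D A \<and> sp_le n D B" if "sp_le n D (sp_meet A B)"
    using refines_trans[OF that] refines_common_refinement[OF P] unfolding sp_meet_def by blast
  show "sp_le n D (sp_meet A B)" if "sp_le n D A \<and> sp_le n D B"
    unfolding sp_meet_def
    by (rule common_refinement_coarsest) (use P that in \<open>auto simp: refines_def\<close>)
qed

text \<open>The join is encoded as the meet of all common upper bounds. Its universal property then
  comes from that of common refinements, without describing its parts.\<close>

definition sp_join :: "nat \<Rightarrow> nat set set \<Rightarrow> nat set set \<Rightarrow> nat set set" where
  "sp_join n A B = common_refinement {C. sp_le n A C \<and> sp_le n B C}"

lemma sp_join_le_iff: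
  assumes "A \<in> SP n" "B \<in> SP n"
  shows "sp_le n (sp_join n A B) C \<longleftrightarrow> sp_le n A C \<and> sp_le n B C"
proof
  let ?U = "{C. sp_le n A C \<and> sp_le n B C}"
  have P: "\<And>P. P \<in> ?U \<Longrightarrow> partition_on {1..n} P"
    by (auto simp: refines_def)
  \<comment> \<open>The top partition is a common upper bound. Nonemptiness is required for the
    common refinement to be the coarsest lower bound of the family.\<close>
  have ne: "?U \<noteq> {}"
    using assms sp_le_top by blast
  show "sp_le n (sp_join n A B) C" if "sp_le n A C \<and> sp_le n B C"
    unfolding sp_join_def by (rule refines_common_refinement[OF P]) (use that in auto)
  have "sp_le n A (sp_join n A B)" "sp_le n B (sp_join n A B)"
    unfolding sp_join_def
    by (rule common_refinement_coarsest[OF P _ _ ne]; use assms in \<open>auto simp: SP_def\<close>)+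
  then show "sp_le n A C \<and> sp_le n B C" if "sp_le n (sp_join n A B) C"
    using that refines_trans by blast
qed

lemma sp_join_SP: "A \<in> SP n \<Longrightarrow> B \<in> SP n \<Longrightarrow> sp_join n A B \<in> SP n"
  using sp_join_le_iff[of A n B "sp_top n"] sp_le_top sp_le_SP by blast

text \<open>Each partition lies in its own upper set, so equal upper sets give equality by
  antisymmetry. Identities between joins become propositional statements about upper bounds.\<close>

lemma sp_eq_iff:
  assumes "A \<in> SP n" "B \<in> SP n"
  shows "A = B \<longleftrightarrow> (\<forall>C\<in>SP n. sp_le n A C \<longleftrightarrow> sp_le n B C)"
  using assms refines_asym sp_le_refl by blast

lemma sp_join_assoc:
  assumes "A \<in> SP n" "B \<in> SP n" "C \<in> SP n"
  shows "sp_join n (sp_join n A B) C = sp_join n A (sp_join n B C)"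
  by (subst sp_eq_iff[of _ n]) (use assms in \<open>auto simp: sp_join_SP sp_join_le_iff\<close>)

lemma sp_join_commute:
  assumes "A \<in> SP n" "B \<in> SP n"
  shows "sp_join n A B = sp_join n B A"
  by (subst sp_eq_iff[of _ n]) (use assms in \<open>auto simp: sp_join_SP sp_join_le_iff\<close>)

text \<open>The finest partition is neutral for the join and will be the degree \<open>n\<close>
  component of the formal unit. For \<open>n = 0\<close> it is the empty partition.\<close>

definition sp_bot :: "nat \<Rightarrow> nat set set" where
  "sp_bot n = (\<lambda>x. {x}) ` {1..n}"

lemma sp_bot_SP [simp]: "sp_bot n \<in> SP n"
  by (simp add: sp_bot_def SP_def partition_on_singletons)

lemma sp_bot_le: "A \<in> SP n \<Longrightarrow> sp_le n (sp_bot n) A"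
  unfolding refines_def
proof (intro conjI ballI)
  fix X assume "A \<in> SP n" "X \<in> sp_bot n"
  then obtain x where "X = {x}" "x \<in> {1..n}" "\<Union>A = {1..n}"
    by (auto simp: sp_bot_def SP_def partition_on_def)
  then have "X = {x}" "x \<in> \<Union>A"
    by simp_all
  then show "\<exists>Y\<in>A. X \<subseteq> Y"
    by auto
qed (use sp_bot_SP[of n] in \<open>auto simp: SP_def simp del: sp_bot_SP\<close>)

lemma sp_join_bot:
  assumes "A \<in> SP n"
  shows "sp_join n (sp_bot n) A = A" "sp_join n A (sp_bot n) = A"
proof -
  show "sp_join n (sp_bot n) A = A"
    by (subst sp_eq_iff[of _ n]) (use assms in \<open>auto simp: sp_join_SP sp_join_le_iff sp_bot_le\<close>)
  with assms show "sp_join n A (sp_bot n) = A"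
    by (simp add: sp_join_commute)
qed

section \<open>Concatenation of set partitions and its interplay with order and join\<close>

lemma sp_bar_SP [simp]:
  assumes "A \<in> SP k" "B \<in> SP l"
  shows "sp_bar k A B \<in> SP (k + l)"
proof -
  have A: "\<Union>A = {1..k}" "disjoint A" "{} \<notin> A" and B: "\<Union>B = {1..l}" "disjoint B" "{} \<notin> B"
    using assms by (auto simp: SP_def partition_on_def)
  have img: "(+) k ` {1..l} = {k+1..k+l}"
    by simp
  have shift: "\<Union>((\<lambda>b. (+) k ` b) ` B) = {k+1..k+l}"
    unfolding image_UN[symmetric] img[symmetric] B(1)[symmetric] by blast
  then have "\<Union>(sp_bar k A B) = {1..k+l}"
    using A(1) by (auto simp: sp_bar_def)
  moreover have "disjoint (sp_bar k A B)"
    unfolding sp_bar_def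
  proof (rule disjoint_union)
    show "disjoint ((\<lambda>b. (+) k ` b) ` B)"
      using B(2) by (force simp: disjoint_def)
    show "\<Union>A \<inter> \<Union>((\<lambda>b. (+) k ` b) ` B) = {}"
      unfolding A(1) shift by auto
  qed (rule A)
  ultimately show ?thesis
    using A(3) B(3) by (auto simp: SP_def partition_on_def sp_bar_def)
qed

text \<open>Parts are nonempty, and those of the left factor lie in \<open>{1..k}\<close> while the
  shifted ones lie above \<open>k\<close>. No part fits into a part from the other side, so the
  comparison splits.\<close>

lemma sp_bar_le_iff:
  assumes "A \<in> SP k" "X \<in> SP k" "B \<in> SP l" "Y \<in> SP l"
  shows "sp_le (k + l) (sp_bar k A B) (sp_bar k X Y) \<longleftrightarrow> sp_le k A X \<and> sp_le l B Y"
proof -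
  have part: "P \<subseteq> {1..m} \<and> P \<noteq> {}" if "P \<in> E" "E \<in> SP m" for P E m
    using that by (auto simp: SP_def partition_on_def)
  have 1: "\<not> P \<subseteq> (+) k ` Q" if PQ: "P \<in> A" "Q \<in> Y" for P Q
  proof
    assume sub: "P \<subseteq> (+) k ` Q"
    obtain x where x: "x \<in> P" "x \<le> k"
      using part[OF PQ(1) assms(1)] by fastforce
    then obtain y where "y \<in> Q" "x = k + y"
      using sub by blast
    then show False
      using part[OF PQ(2) assms(4)] x by auto
  qed
  have 2: "\<not> (+) k ` P \<subseteq> Q" if PQ: "P \<in> B" "Q \<in> X" for P Q
  proof
    assume sub: "(+) k ` P \<subseteq> Q"
    obtain x where x: "x \<in> P" "x \<ge> 1"
      using part[OF PQ(1) assms(3)] by fastforce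
    then have "k + x \<in> Q"
      using sub by blast
    then show False
      using part[OF PQ(2) assms(2)] x by auto
  qed
  have 3: "(+) k ` P \<subseteq> (+) k ` Q \<longleftrightarrow> P \<subseteq> Q" for P Q
    by (simp add: inj_image_subset_iff)
  have "sp_bar k A B \<in> SP (k + l)" "sp_bar k X Y \<in> SP (k + l)"
    using assms by simp_all
  then have "sp_le (k + l) (sp_bar k A B) (sp_bar k X Y) \<longleftrightarrow>
      (\<forall>P\<in>sp_bar k A B. \<exists>Q\<in>sp_bar k X Y. P \<subseteq> Q)"
    by (simp add: refines_def SP_def)
  also have "\<dots> \<longleftrightarrow> (\<forall>P\<in>A. \<exists>Q\<in>X. P \<subseteq> Q) \<and> (\<forall>P\<in>B. \<exists>Q\<in>Y. P \<subseteq> Q)"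
  proof -
    have "(\<exists>Q\<in>sp_bar k X Y. P \<subseteq> Q) \<longleftrightarrow> (\<exists>Q\<in>X. P \<subseteq> Q)" if "P \<in> A" for P
      using 1[OF that] unfolding sp_bar_def by blast
    moreover have "(\<exists>Q\<in>sp_bar k X Y. (+) k ` P \<subseteq> Q) \<longleftrightarrow> (\<exists>Q\<in>Y. P \<subseteq> Q)" if "P \<in> B" for P
      using 2[OF that] by (simp add: sp_bar_def bex_Un 3)
    moreover have "(\<forall>P\<in>sp_bar k A B. R P) \<longleftrightarrow> (\<forall>P\<in>A. R P) \<and> (\<forall>P\<in>B. R ((+) k ` P))" for R
      by (simp add: sp_bar_def ball_Un)
    ultimately show ?thesis
      by simp
  qed
  finally have "sp_le (k + l) (sp_bar k A B) (sp_bar k X Y) \<longleftrightarrow> \<dots>" .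
  with assms show ?thesis
    by (simp add: refines_def SP_def)
qed

text \<open>Antisymmetry turns the order criterion into injectivity: at a fixed place a partition is
  cut in at most one way.\<close>

lemma sp_bar_eq_iff:
  assumes "A \<in> SP k" "X \<in> SP k" "B \<in> SP l" "Y \<in> SP l"
  shows "sp_bar k A B = sp_bar k X Y \<longleftrightarrow> A = X \<and> B = Y"
proof
  assume eq: "sp_bar k A B = sp_bar k X Y"
  have "sp_le (k + l) (sp_bar k A B) (sp_bar k A B)"
    using assms by (intro sp_le_refl) auto
  then have "sp_le (k + l) (sp_bar k A B) (sp_bar k X Y)" "sp_le (k + l) (sp_bar k X Y) (sp_bar k A B)"
    by (simp_all add: eq)
  then show "A = X \<and> B = Y"
    using assms refines_asym by (metis sp_bar_le_iff)
qed simp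

text \<open>Every part of \<open>E\<close> stays on one side of the cut after \<open>k\<close>.
  Collecting the left parts, and the right parts shifted back, yields the two factors.\<close>

lemma sp_le_bar_topE:
  assumes "sp_le (k + l) E (sp_bar k (sp_top k) (sp_top l))"
  obtains B C where "B \<in> SP k" "C \<in> SP l" "E = sp_bar k B C"
proof -
  have E: "\<Union>E = {1..k+l}" "disjoint E" "{} \<notin> E"
    using sp_le_SP[OF assms] by (auto simp: SP_def partition_on_def)
  have cut: "X \<subseteq> {1..k} \<or> X \<subseteq> (+) k ` {1..l}" if "X \<in> E" for X
    using assms that by (auto simp: refines_def sp_bar_def sp_top_def)
  define B where "B = {X \<in> E. X \<subseteq> {1..k}}"
  \<comment> \<open>The bound on \<open>Y\<close> excludes the element \<open>0\<close>, whose shift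
    is \<open>k\<close>: a left part \<open>{k}\<close> is also the shift of
    \<open>{0}\<close>.\<close>
  define C where "C = {Y. (+) k ` Y \<in> E \<and> Y \<subseteq> {1..l}}"
  have E_eq: "E = sp_bar k B C"
  proof
    show "E \<subseteq> sp_bar k B C"
    proof
      fix X assume X: "X \<in> E"
      from cut[OF X] show "X \<in> sp_bar k B C"
      proof
        assume "X \<subseteq> (+) k ` {1..l}"
        then obtain Y where "Y \<subseteq> {1..l}" "X = (+) k ` Y"
          by (rule subset_imageE)
        with X show ?thesis
          by (auto simp: sp_bar_def C_def)
      qed (use X in \<open>auto simp: sp_bar_def B_def\<close>)
    qed
  qed (auto simp: sp_bar_def B_def C_def)
  have "B \<in> SP k"
    unfolding SP_def
  proof (simp, intro partition_onI)
    show "\<Union>B = {1..k}"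
    proof
      show "{1..k} \<subseteq> \<Union>B"
      proof
        fix x assume x: "x \<in> {1..k}"
        then have "x \<in> \<Union>E" by (simp add: E)
        then obtain X where X: "x \<in> X" "X \<in> E" by blast
        with cut[of X] x show "x \<in> \<Union>B"
          by (fastforce simp: B_def)
      qed
    qed (auto simp: B_def)
  qed (use E in \<open>auto simp: B_def disjoint_def disjnt_def\<close>)
  moreover have "C \<in> SP l"
    unfolding SP_def
  proof (simp, intro partition_onI)
    show "\<Union>C = {1..l}"
    proof
      show "{1..l} \<subseteq> \<Union>C"
      proof
        fix x assume x: "x \<in> {1..l}"
        then have "k + x \<in> \<Union>E" by (simp add: E)
        then obtain X where X: "k + x \<in> X" "X \<in> E" by blast
        with cut[of X] x have "X \<subseteq> (+) k ` {1..l}"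
          by fastforce
        then obtain Y where "Y \<subseteq> {1..l}" "X = (+) k ` Y"
          by (rule subset_imageE)
        with X show "x \<in> \<Union>C"
          by (auto simp: C_def)
      qed
    qed (auto simp: C_def)
    show "disjnt P Q" if "P \<in> C" "Q \<in> C" "P \<noteq> Q" for P Q
    proof -
      \<comment> \<open>The shift is injective, so distinct sets in \<open>C\<close> come from
        distinct, hence disjoint, parts of \<open>E\<close>.\<close>
      have "(+) k ` P \<noteq> (+) k ` Q"
        using that(3) by (simp add: inj_image_eq_iff)
      then have "(+) k ` P \<inter> (+) k ` Q = {}"
        using that E(2) by (auto simp: C_def disjoint_def)
      then show ?thesis
        by (auto simp: disjnt_def)
    qed
  qed (use E in \<open>auto simp: C_def\<close>)
  ultimately show ?thesis
    using that E_eq by blast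
qed

text \<open>The right side is an upper bound, so the join lies below it and therefore below
  \<open>1|1\<close>. Thus the join is itself some \<open>P|Q\<close>, where \<open>P\<close> bounds
  \<open>A\<close> and \<open>X\<close> and \<open>Q\<close> bounds \<open>B\<close> and
  \<open>Y\<close>; this gives the reverse inequality.\<close>

lemma sp_join_bar:
  assumes "A \<in> SP k" "X \<in> SP k" "B \<in> SP l" "Y \<in> SP l"
  shows "sp_join (k + l) (sp_bar k A B) (sp_bar k X Y) = sp_bar k (sp_join k A X) (sp_join l B Y)"
    (is "?J = ?R")
proof -
  have J: "?J \<in> SP (k + l)"
    using assms by (simp add: sp_join_SP)
  have join: "sp_join k A X \<in> SP k" "sp_join l B Y \<in> SP l"
    using assms by (simp_all add: sp_join_SP)
  have ub: "sp_le k A (sp_join k A X)" "sp_le k X (sp_join k A X)"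
      "sp_le l B (sp_join l B Y)" "sp_le l Y (sp_join l B Y)"
    using sp_join_le_iff[OF assms(1,2)] sp_le_refl[OF join(1)]
      sp_join_le_iff[OF assms(3,4)] sp_le_refl[OF join(2)] by blast+
  have le: "sp_le (k + l) ?J ?R"
    using assms join ub by (simp add: sp_join_le_iff sp_bar_le_iff)
  moreover have "sp_le (k + l) ?R (sp_bar k (sp_top k) (sp_top l))"
    using join by (simp add: sp_bar_le_iff sp_le_top)
  ultimately have "sp_le (k + l) ?J (sp_bar k (sp_top k) (sp_top l))"
    by (rule refines_trans)
  then obtain P Q where PQ: "P \<in> SP k" "Q \<in> SP l" "?J = sp_bar k P Q"
    by (rule sp_le_bar_topE)
  have "sp_le (k + l) ?J (sp_bar k P Q)"
    using sp_le_refl[OF J] PQ(3) by simp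
  then have "sp_le k A P \<and> sp_le k X P \<and> sp_le l B Q \<and> sp_le l Y Q"
    using assms PQ(1,2) sp_join_le_iff[of "sp_bar k A B" "k + l" "sp_bar k X Y"]
    by (simp add: sp_bar_le_iff)
  then have "sp_le (k + l) ?R ?J"
    using assms PQ join by (simp add: sp_join_le_iff sp_bar_le_iff)
  with le show ?thesis
    by (rule refines_asym)
qed

lemma sp_bar_bot: "sp_bar k (sp_bot k) (sp_bot l) = sp_bot (k + l)"
proof -
  have "{1..k+l} = {1..k} \<union> (+) k ` {1..l}"
    by auto
  then have "sp_bot (k + l) = sp_bot k \<union> (\<lambda>x. {x}) ` (+) k ` {1..l}"
    by (simp only: sp_bot_def image_Un)
  then show ?thesis
    unfolding sp_bar_def sp_bot_def image_image by simp
qed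

lemma sp_bar_assoc: "sp_bar k A (sp_bar l B C) = sp_bar (k + l) (sp_bar k A B) C"
  by (simp add: sp_bar_def image_Un image_image Un_assoc add.assoc)

lemma sp_bar_empty [simp]: "sp_bar 0 {} A = A" "sp_bar k A {} = A"
  by (simp_all add: sp_bar_def)


section \<open>Idempotents and classes of modules\<close>

text \<open>The recursion makes the value of the Moebius function at the top of a nontrivial
  interval cancel the sum of all others.\<close>

lemma sum_sp_mu:
  assumes "B \<in> SP n" "X \<in> SP n"
  shows "(\<Sum>A | sp_le n B A \<and> sp_le n A X. sp_mu n B A) = (if B = X then 1 else 0)"
proof (cases "sp_le n B X")
  case True
  let ?S = "{A. sp_le n B A \<and> sp_le n A X}"
  have X: "X \<in> ?S" using True assms sp_le_refl by blast
  have "?S - {X} = {A. sp_le n B A \<and> sp_le n A X \<and> A \<noteq> X}" by auto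
  with X have "sum (sp_mu n B) ?S = sp_mu n B X + (\<Sum>A | sp_le n B A \<and> sp_le n A X \<and> A \<noteq> X. sp_mu n B A)"
    by (simp add: sum.remove[of _ X])
  \<comment> \<open>In the case \<open>B = X\<close> antisymmetry leaves no other term, and the sum
    is \<open>sp_mu n X X\<close>, which is \<open>1\<close>.\<close>
  moreover have "{A. sp_le n X A \<and> sp_le n A X \<and> A \<noteq> X} = {}"
    using refines_asym by blast
  ultimately show ?thesis
    using True by (cases "B = X") (simp_all add: sp_mu.simps[of n B X] sp_mu.simps[of n X X])
next
  case False
  then have empty: "{A. sp_le n B A \<and> sp_le n A X} = {}"
    using refines_trans by blast
  have "B \<noteq> X"
    using False sp_le_refl[OF assms(1)] by blast
  then show ?thesis
    unfolding empty by simp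
qed

lemma lookup_sp_idem:
  "Poly_Mapping.lookup (sp_idem n A) B = (if sp_le n B A then of_int (sp_mu n B A) else 0)"
  by (simp add: sp_idem_def lookup_sum lookup_single when_def if_distrib[of "(*) _"] sum.delta' cong: if_cong)

text \<open>Moebius inversion: the coefficient of \<open>B\<close> on the left is the sum of the
  Moebius function over the interval from \<open>B\<close> to \<open>X\<close>.\<close>

lemma sum_sp_idem:
  assumes "X \<in> SP n"
  shows "(\<Sum>A | sp_le n A X. sp_idem n A) = basis X"
proof (rule poly_mapping_eqI)
  fix B
  have "Poly_Mapping.lookup (\<Sum>A | sp_le n A X. sp_idem n A) B =
      (\<Sum>A | sp_le n B A \<and> sp_le n A X. of_int (sp_mu n B A))"
    unfolding lookup_sum lookup_sp_idem
    by (rule sum.mono_neutral_cong_right) auto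
  also have "\<dots> = of_int (if B = X then 1 else 0)"
  proof (cases "B \<in> SP n")
    case True
    show ?thesis
      by (simp only: of_int_sum[symmetric] sum_sp_mu[OF True assms])
  next
    case False
    then have empty: "{A. sp_le n B A \<and> sp_le n A X} = {}" and "B \<noteq> X"
      using sp_le_SP assms by blast+
    then show ?thesis unfolding empty by simp
  qed
  finally show "Poly_Mapping.lookup (\<Sum>A | sp_le n A X. sp_idem n A) B = Poly_Mapping.lookup (basis X) B"
    by (cases "B = X") (simp_all add: lookup_single when_def)
qed

text \<open>The coefficient of \<open>A\<close> itself is \<open>sp_mu n A A\<close>, which is
  \<open>1\<close>.\<close>

lemma sp_idem_nonzero: "sp_idem n A \<noteq> 0" if "A \<in> SP n"
proof
  assume "sp_idem n A = (0 :: _ \<Rightarrow>\<^sub>0 'a)"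
  then have "Poly_Mapping.lookup (sp_idem n A :: _ \<Rightarrow>\<^sub>0 'a) A = 0"
    by simp
  then show False
    using that by (simp add: lookup_sp_idem sp_le_refl sp_mu.simps)
qed

lemma linear_wedge: "linear_on UNIV (wedge x)" "linear_on UNIV (\<lambda>x. wedge x y)"
  unfolding wedge_def by (rule linear_bilin_ext)+

text \<open>Multiply \<open>\<Sum>\<^sub>E\<^sub>\<le>\<^sub>A e\<^sub>E = A\<close> by \<open>C\<close> and compare with the same expansion of \<open>C \<and> A\<close>.\<close>

lemma wedge_sp_idem:
  assumes C: "C \<in> SP n" and "A \<in> SP n"
  shows "wedge (basis C) (sp_idem n A) = (if sp_le n A C then sp_idem n A else (0 :: _ \<Rightarrow>\<^sub>0 'k::field))"
  using assms(2)
\<comment> \<open>Induction on the size of the lower set of \<open>A\<close>. The terms strictly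
  below \<open>A\<close> are known and cancel, leaving the claim for \<open>A\<close>.\<close>
proof (induction "card {E. sp_le n E A}" arbitrary: A rule: less_induct)
  case (less A)
  define e :: "nat set set \<Rightarrow> nat set set \<Rightarrow>\<^sub>0 'k" where "e E = (if sp_le n E C then sp_idem n E else 0)" for E
  have A: "A \<in> {E. sp_le n E A}"
    using less.prems sp_le_refl by simp
  have IH: "wedge (basis C) (sp_idem n E) = e E" if E: "E \<in> {E. sp_le n E A} - {A}" for E
    unfolding e_def
  proof (rule less.hyps)
    have "\<not> sp_le n A E"
      using E refines_asym by auto
    then have "{F. sp_le n F E} \<subset> {F. sp_le n F A}"
      using E A refines_trans by blast
    then show "card {F. sp_le n F E} < card {F. sp_le n F A}"
      by (intro psubset_card_mono) auto
    show "E \<in> SP n"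
      using E sp_le_SP by auto
  qed
  have "wedge (basis C) (sp_idem n A) + (\<Sum>E\<in>{E. sp_le n E A} - {A}. e E)
      = (\<Sum>E | sp_le n E A. wedge (basis C) (sp_idem n E))"
    using IH by (simp add: sum.remove[OF _ A])
  also have "\<dots> = wedge (basis C) (basis A)"
    by (simp add: linear_on_sum[OF linear_wedge(1), symmetric] sum_sp_idem less.prems)
  also have "\<dots> = basis (sp_meet C A)"
    by (simp add: wedge_def)
  also have "\<dots> = (\<Sum>E | sp_le n E (sp_meet C A). sp_idem n E)"
    using C less.prems by (simp add: sum_sp_idem sp_meet_SP)
  \<comment> \<open>Below the meet means below both \<open>C\<close> and \<open>A\<close>; the
    default value \<open>0\<close> of \<open>e\<close> removes the \<open>E\<close> that are not
    below \<open>C\<close>.\<close>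
  also have "\<dots> = (\<Sum>E | sp_le n E A. e E)"
    unfolding e_def using C less.prems
    by (intro sum.mono_neutral_cong_left) (auto simp: sp_le_meet_iff)
  also have "\<dots> = e A + (\<Sum>E\<in>{E. sp_le n E A} - {A}. e E)"
    by (simp add: sum.remove[OF _ A])
  finally show ?case
    by (simp add: e_def)
qed

section \<open>Characters of the simple modules and the classes obtained from them\<close>

definition sp_char :: "nat \<Rightarrow> nat set set \<Rightarrow> nat set set \<Rightarrow> 'k::field" where
  "sp_char n A C = (if sp_le n A C then 1 else 0)"

lemma line_module_simple:
  assumes A: "A \<in> SP n"
  shows "line_module (SP n) (sp_char n A) (simple_mod n A :: (_, _, 'k::field) amodule)"
  unfolding line_module_def
proof (intro exI[of _ "sp_idem n A"] conjI ballI)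
  let ?e = "sp_idem n A :: nat set set \<Rightarrow>\<^sub>0 'k"
  have act: "wedge (basis C) (scl c ?e) = scl (sp_char n A C) (scl c ?e)" if "C \<in> SP n" for C c
    using that A by (simp add: wedge_def bilin_ext_simps)
      (simp add: wedge_def[symmetric] wedge_sp_idem sp_char_def)
  show fst: "fst (simple_mod n A) = range (\<lambda>c. scl c ?e)"
  proof
    have "wedge x ?e \<in> range (\<lambda>c. scl c ?e)" if "x \<in> free_on (SP n)" for x
      using that
    proof (induction x rule: free_on_induct)
      case zero
      then show ?case
        using subspace_line[of ?e] by (simp add: wedge_def bilin_ext_simps pm.subspace_0)
    next
      case (add x y)
      then show ?case
        using subspace_line[of ?e] by (simp add: wedge_def bilin_ext_simps pm.subspace_add)
    next
      case (scl c x)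
      then show ?case
        using subspace_line[of ?e] by (simp add: wedge_def bilin_ext_simps pm.subspace_scale)
    next
      case (basis C)
      then show ?case
        using act[of C 1] by auto
    qed
    then show "fst (simple_mod n A) \<subseteq> range (\<lambda>c. scl c ?e)"
      by (auto simp: simple_mod_def)
    \<comment> \<open>Since \<open>A\<close> fixes its own idempotent, every multiple of the
      idempotent is reached by acting with the same multiple of \<open>A\<close>.\<close>
    have "scl c ?e = wedge (scl c (basis A)) ?e" for c
      using wedge_sp_idem[OF A A, where 'k = 'k] A
      by (simp add: wedge_def bilin_ext_simps sp_le_refl)
    moreover have "scl c (basis A) \<in> free_on (SP n)" for c :: 'k
      using A by auto
    ultimately show "range (\<lambda>c. scl c ?e) \<subseteq> fst (simple_mod n A)"
      by (force simp: simple_mod_def)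
  qed
  show "snd (simple_mod n A) C x = scl (sp_char n A C) x"
    if "C \<in> SP n" "x \<in> fst (simple_mod n A)" for C and x :: "nat set set \<Rightarrow>\<^sub>0 'k"
    using that act unfolding fst by (auto simp: simple_mod_def)
qed (rule sp_idem_nonzero[OF A])

lemma linear_simple_mod: "linear_on UNIV (snd (simple_mod n A) C)"
  by (simp add: simple_mod_def linear_wedge)

text \<open>The character is the indicator of the upper set of the partition, and the upper set
  determines the partition.\<close>

lemma sp_char_inj:
  assumes "A \<in> SP n" "B \<in> SP n" "\<And>C. C \<in> SP n \<Longrightarrow> sp_char n A C = (sp_char n B C :: 'k::field)"
  shows "A = B"
  using assms(3) sp_eq_iff[OF assms(1,2)] by (fastforce simp: sp_char_def split: if_splits)

text \<open>Diagonal tensoring multiplies characters, and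
  \<open>[A \<le> C] [B \<le> C] = [A \<or> B \<le> C]\<close> by the universal property of the
  join.\<close>

lemma cls_diag_tens:
  assumes A: "A \<in> SP n" and B: "B \<in> SP n"
  shows "cls n (diag_tens_mod (simple_mod n A) (simple_mod n B)) = (basis (sp_join n A B) :: _ \<Rightarrow>\<^sub>0 'k::field)"
  unfolding cls_def
proof (rule G0_class_line)
  show "\<forall>A\<in>SP n. line_module (SP n) (sp_char n A) (simple_mod n A :: (_, _, 'k) amodule)"
    by (simp add: line_module_simple)
  show "\<forall>A\<in>SP n. \<forall>B\<in>SP n. (\<forall>C\<in>SP n. sp_char n A C = (sp_char n B C :: 'k)) \<longrightarrow> A = B"
    using sp_char_inj by blast
  have "line_module (SP n) (\<lambda>C. sp_char n A C * sp_char n B C)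
      (diag_tens_mod (simple_mod n A) (simple_mod n B) :: (_, _, 'k) amodule)"
    using A B by (intro line_module_diag_tens line_module_simple linear_simple_mod)
  then show "line_module (SP n) (sp_char n (sp_join n A B))
      (diag_tens_mod (simple_mod n A) (simple_mod n B) :: (_, _, 'k) amodule)"
    by (rule line_module_cong) (use A B in \<open>simp add: sp_char_def sp_join_le_iff\<close>)
  show "sp_join n A B \<in> SP n"
    using A B by (rule sp_join_SP)
qed

definition sp_char2 :: "nat \<Rightarrow> nat \<Rightarrow> nat set set \<times> nat set set \<Rightarrow> nat set set \<times> nat set set \<Rightarrow> 'k::field"
  where "sp_char2 k l p q = sp_char k (fst p) (fst q) * sp_char l (snd p) (snd q)"

lemma line_module_ext_simple:
  "\<forall>p\<in>SP k \<times> SP l. line_module (SP k \<times> SP l) (sp_char2 k l p)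
     ((\<lambda>(B, C). ext_tens_mod (simple_mod k B) (simple_mod l C)) p :: (_, _, 'k::field) amodule)"
proof (clarify)
  fix B C assume "B \<in> SP k" "C \<in> SP l"
  then have "line_module (SP k \<times> SP l) (\<lambda>(X, Y). sp_char k B X * sp_char l C Y)
      (ext_tens_mod (simple_mod k B) (simple_mod l C) :: (_, _, 'k) amodule)"
    by (intro line_module_ext_tens line_module_simple linear_simple_mod)
  then show "line_module (SP k \<times> SP l) (sp_char2 k l (B, C))
      (ext_tens_mod (simple_mod k B) (simple_mod l C) :: (_, _, 'k) amodule)"
    by (rule line_module_cong) (auto simp: sp_char2_def)
qed

text \<open>Here \<open>1|1\<close> lies above \<open>B|C\<close> and acts as the identity, so
  restriction keeps the whole line. On it \<open>X|Y\<close> acts by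
  \<open>[B \<le> X] [C \<le> Y]\<close>, the character of the external tensor product.\<close>

lemma cls2_res_mod:
  assumes B: "B \<in> SP k" and C: "C \<in> SP l"
  shows "cls2 k l (res_mod k l (simple_mod (k + l) (sp_bar k B C))) = (basis (B, C) :: _ \<Rightarrow>\<^sub>0 'k::field)"
  unfolding cls2_def
proof (rule G0_class_line[OF line_module_ext_simple])
  let ?A = "sp_bar k B C"
  show "\<forall>p\<in>SP k \<times> SP l. \<forall>q\<in>SP k \<times> SP l.
      (\<forall>r\<in>SP k \<times> SP l. sp_char2 k l p r = (sp_char2 k l q r :: 'k)) \<longrightarrow> p = q"
  proof clarify
    fix P Q P' Q'
    assume P: "P \<in> SP k" "P' \<in> SP k" and Q: "Q \<in> SP l" "Q' \<in> SP l"
      and eq: "\<forall>r\<in>SP k \<times> SP l. sp_char2 k l (P, Q) r = (sp_char2 k l (P', Q') r :: 'k)"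
    \<comment> \<open>Each character takes the value \<open>1\<close> at its own index, so
      evaluating at the two indices gives the inequalities in both directions.\<close>
    from P Q eq have "sp_char2 k l (P, Q) (P, Q) = (sp_char2 k l (P', Q') (P, Q) :: 'k)"
      "sp_char2 k l (P, Q) (P', Q') = (sp_char2 k l (P', Q') (P', Q') :: 'k)"
      by blast+
    with P Q have "sp_le k P P'" "sp_le k P' P" "sp_le l Q Q'" "sp_le l Q' Q"
      by (auto simp: sp_char2_def sp_char_def sp_le_refl split: if_splits)
    then show "P = P' \<and> Q = Q'"
      using refines_asym by blast
  qed
  have A: "?A \<in> SP (k + l)"
    using B C by simp
  obtain v :: "nat set set \<Rightarrow>\<^sub>0 'k" where v: "v \<noteq> 0" "fst (simple_mod (k + l) ?A) = range (\<lambda>c. scl c v)"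
    and act: "\<And>D x. D \<in> SP (k + l) \<Longrightarrow> x \<in> fst (simple_mod (k + l) ?A) \<Longrightarrow>
        snd (simple_mod (k + l) ?A) D x = scl (sp_char (k + l) ?A D :: 'k) x"
    using line_module_simple[OF A, where 'k = 'k] by (rule line_moduleE) blast
  have act_bar: "snd (simple_mod (k + l) ?A) (sp_bar k X Y) x = scl (sp_char2 k l (B, C) (X, Y)) x"
    if "X \<in> SP k" "Y \<in> SP l" "x \<in> fst (simple_mod (k + l) ?A)" for X Y and x :: "_ \<Rightarrow>\<^sub>0 'k"
    using that B C act[of "sp_bar k X Y" x]
    by (simp add: sp_char2_def sp_char_def sp_bar_le_iff)
  have "sp_char2 k l (B, C) (sp_top k, sp_top l) = (1 :: 'k)"
    using B C by (simp add: sp_char2_def sp_char_def sp_le_top)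
  then have "fst (res_mod k l (simple_mod (k + l) ?A)) = (fst (simple_mod (k + l) ?A) :: (_ \<Rightarrow>\<^sub>0 'k) set)"
    using act_bar[of "sp_top k" "sp_top l"] by (auto simp: res_mod_def)
  then show "line_module (SP k \<times> SP l) (sp_char2 k l (B, C))
      (res_mod k l (simple_mod (k + l) ?A) :: (_, _, 'k) amodule)"
    unfolding line_module_def
    using v act_bar by (intro exI[of _ v]) (auto simp: res_mod_def)
  show "(B, C) \<in> SP k \<times> SP l"
    using B C by simp
qed

text \<open>A partition that cannot be cut at \<open>k\<close> is not below \<open>1|1\<close>, so
  \<open>1|1\<close> annihilates its simple module and fixes only \<open>0\<close>.\<close>

lemma cls2_res_mod_zero:
  assumes A: "A \<in> SP (k + l)" and no: "\<And>B C. B \<in> SP k \<Longrightarrow> C \<in> SP l \<Longrightarrow> A \<noteq> sp_bar k B C"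
  shows "cls2 k l (res_mod k l (simple_mod (k + l) A)) = (0 :: _ \<Rightarrow>\<^sub>0 'k::field)"
  unfolding cls2_def
proof (rule G0_class_trivial[OF line_module_ext_simple])
  let ?T = "sp_bar k (sp_top k) (sp_top l)"
  obtain v :: "nat set set \<Rightarrow>\<^sub>0 'k" where v: "fst (simple_mod (k + l) A) = range (\<lambda>c. scl c v)"
    and act: "\<And>D x. D \<in> SP (k + l) \<Longrightarrow> x \<in> fst (simple_mod (k + l) A) \<Longrightarrow>
        snd (simple_mod (k + l) A) D x = scl (sp_char (k + l) A D :: 'k) x"
    using line_module_simple[OF A, where 'k = 'k] by (rule line_moduleE) blast
  have "\<not> sp_le (k + l) A ?T"
    using no by (metis sp_le_bar_topE)
  then have "snd (simple_mod (k + l) A) ?T x = 0" if "x \<in> fst (simple_mod (k + l) A)" for x :: "_ \<Rightarrow>\<^sub>0 'k"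
    using act[OF _ that, of ?T] by (simp add: sp_char_def)
  moreover have "(0 :: _ \<Rightarrow>\<^sub>0 'k) \<in> fst (simple_mod (k + l) A)"
    unfolding v by (rule pm.subspace_0[OF subspace_line])
  ultimately show "fst (res_mod k l (simple_mod (k + l) A) :: (_, _, 'k) amodule) = {0}"
    by (auto simp: res_mod_def)
qed

section \<open>Product and coproduct on the basis of simple classes\<close>

lemma G0_prod_basis:
  assumes "A \<in> SP n" "B \<in> SP m"
  shows "G0_prod (basis A) (basis B) = (if m = n then basis (sp_join n A B) else 0)"
  using assms by (cases "m = n") (simp_all add: G0_prod_def cls_diag_tens)

text \<open>The index set of the coproduct, over all places at once. The place of a cut need not be
  stored, being the degree of the left piece.\<close>

definition sp_cuts :: "nat set set \<Rightarrow> (nat set set \<times> nat set set) set" where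
  "sp_cuts A = {(B, C). B \<in> SP_all \<and> C \<in> SP_all \<and> sp_bar (sp_degree B) B C = A}"

lemma sp_cuts_iff:
  assumes "A \<in> SP n"
  shows "(B, C) \<in> sp_cuts A \<longleftrightarrow>
    (\<exists>k\<le>n. B \<in> SP k \<and> C \<in> SP (n - k) \<and> sp_bar k B C = A)"
proof
  assume "(B, C) \<in> sp_cuts A"
  then obtain k l where BC: "B \<in> SP k" "C \<in> SP l" "sp_bar k B C = A"
    by (auto simp: sp_cuts_def SP_all_def)
  then have "k + l = n"
    using assms sp_bar_SP sp_degree_SP by metis
  with BC show "\<exists>k\<le>n. B \<in> SP k \<and> C \<in> SP (n - k) \<and> sp_bar k B C = A"
    by (intro exI[of _ k]) auto
qed (auto simp: sp_cuts_def SP_all_def)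

lemma finite_sp_cuts [simp]:
  assumes "A \<in> SP_all"
  shows "finite (sp_cuts A)"
proof -
  obtain n where "A \<in> SP n"
    using assms by (auto simp: SP_all_def)
  then have "sp_cuts A \<subseteq> (\<Union>k\<le>n. SP k \<times> SP (n - k))"
    by (auto simp: sp_cuts_iff)
  then show ?thesis
    by (rule finite_subset) simp
qed

text \<open>At each place \<open>k\<close> there is at most one cut, matching a class that is either
  a basis vector or zero. Cuts at different places differ because the left pieces have different
  degrees.\<close>

lemma G0_coprod_basis:
  assumes "A \<in> SP_all"
  shows "G0_coprod (basis A) = (\<Sum>p\<in>sp_cuts A. basis p :: _ \<Rightarrow>\<^sub>0 'k::field)"
proof -
  obtain n where A: "A \<in> SP n"
    using assms by (auto simp: SP_all_def)
  define cuts where "cuts k = {(B, C). B \<in> SP k \<and> C \<in> SP (n - k) \<and> sp_bar k B C = A}" for k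
  have "cls2 k (n - k) (res_mod k (n - k) (simple_mod n A)) = (\<Sum>p\<in>cuts k. basis p :: _ \<Rightarrow>\<^sub>0 'k)"
    if k: "k \<le> n" for k
  proof (cases "cuts k = {}")
    case True
    then have "A \<noteq> sp_bar k B C" if "B \<in> SP k" "C \<in> SP (n - k)" for B C
      using that by (auto simp: cuts_def)
    then show ?thesis
      using A k True cls2_res_mod_zero[of A k "n - k", where 'k = 'k] by simp
  next
    case False
    then obtain B C where BC: "B \<in> SP k" "C \<in> SP (n - k)" "sp_bar k B C = A"
      by (auto simp: cuts_def)
    then have "cuts k = {(B, C)}"
      by (auto simp: cuts_def sp_bar_eq_iff)
    then show ?thesis
      using BC k cls2_res_mod[of B k C "n - k", where 'k = 'k] by simp
  qed
  then have "G0_coprod (basis A) = (\<Sum>k\<le>n. \<Sum>p\<in>cuts k. basis p :: _ \<Rightarrow>\<^sub>0 'k)"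
    using A by (simp add: G0_coprod_def)
  also have "\<dots> = (\<Sum>p\<in>(\<Union>k\<le>n. cuts k). basis p)"
  proof (rule sum.UNION_disjoint[symmetric])
    show "\<forall>k\<in>{..n}. finite (cuts k)"
      unfolding cuts_def by (auto intro: finite_subset[of _ "SP _ \<times> SP _"])
    show "\<forall>k\<in>{..n}. \<forall>l\<in>{..n}. k \<noteq> l \<longrightarrow> cuts k \<inter> cuts l = {}"
      by (auto simp: cuts_def dest!: sp_degree_SP)
  qed simp
  also have "(\<Union>k\<le>n. cuts k) = sp_cuts A"
    using sp_cuts_iff[OF A] by (auto simp: cuts_def)
  finally show ?thesis .
qed


section \<open>The bialgebra axioms\<close>

lemma SP_allE:
  assumes "A \<in> SP_all"
  obtains n where "A \<in> SP n"
  using assms by (auto simp: SP_all_def)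

lemma SP_subset_SP_all: "A \<in> SP n \<Longrightarrow> A \<in> SP_all"
  by (auto simp: SP_all_def)

lemma SP_empty_iff: "A \<in> SP n \<Longrightarrow> A = {} \<longleftrightarrow> n = 0"
  by (auto simp: SP_def partition_on_def)

lemma G0_prod_simps:
  "G0_prod 0 y = 0" "G0_prod x 0 = 0"
  "G0_prod (x + x') y = G0_prod x y + G0_prod x' y"
  "G0_prod x (y + y') = G0_prod x y + G0_prod x y'"
  "G0_prod (scl c x) y = scl c (G0_prod x y)"
  "G0_prod x (scl c y) = scl c (G0_prod x y)"
  by (simp_all add: G0_prod_def bilin_ext_simps)

lemma G0_coprod_simps:
  "G0_coprod 0 = 0"
  "G0_coprod (x + x') = G0_coprod x + G0_coprod x'"
  "G0_coprod (scl c x) = scl c (G0_coprod x)"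
  by (simp_all add: G0_coprod_def lin_ext_add lin_ext_scl)

lemma tens_mult_simps:
  "tens_mult m 0 y = 0" "tens_mult m x 0 = 0"
  "tens_mult m (x + x') y = tens_mult m x y + tens_mult m x' y"
  "tens_mult m x (y + y') = tens_mult m x y + tens_mult m x y'"
  "tens_mult m (scl c x) y = scl c (tens_mult m x y)"
  "tens_mult m x (scl c y) = scl c (tens_mult m x y)"
  by (simp_all add: tens_mult_def bilin_ext_simps)

lemma tens_assoc_simps:
  "tens_assoc 0 = 0"
  "tens_assoc (x + x') = tens_assoc x + tens_assoc x'"
  "tens_assoc (scl c x) = scl c (tens_assoc x)"
  "tens_assoc (basis ((a, b), d)) = basis (a, b, d)"
  by (simp_all add: tens_assoc_def lin_ext_add lin_ext_scl)

lemma linear_tens_ops: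
  "linear_on UNIV (\<lambda>x. tens x y)" "linear_on UNIV (tens x)"
  "linear_on UNIV (map_tens f g)" "linear_on UNIV tens_assoc"
  by (simp_all add: linear_on_def tens_simps map_tens_simps tens_assoc_simps)

section \<open>The algebra axioms, then the compatibility of product and coproduct\<close>

lemma G0_prod_closed:
  assumes "x \<in> free_on SP_all" and y: "y \<in> free_on SP_all"
  shows "G0_prod x y \<in> free_on SP_all"
  using assms(1)
proof (induction x rule: free_on_induct)
  case (basis A)
  show ?case
    using y
  proof (induction y rule: free_on_induct)
    case (basis B)
    obtain n m where "A \<in> SP n" "B \<in> SP m"
      using \<open>A \<in> SP_all\<close> \<open>B \<in> SP_all\<close> by (elim SP_allE)
    then show ?case
      by (auto simp: G0_prod_basis intro: SP_subset_SP_all[of _ n] sp_join_SP)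
  qed (auto simp: G0_prod_simps)
qed (auto simp: G0_prod_simps)

lemma G0_prod_assoc:
  assumes "x \<in> free_on SP_all" and y: "y \<in> free_on SP_all" and z: "z \<in> free_on SP_all"
  shows "G0_prod (G0_prod x y) z = G0_prod x (G0_prod y z)"
  using assms(1)
proof (induction x rule: free_on_induct)
  case (basis A)
  show ?case
    using y
  proof (induction y rule: free_on_induct)
    case (basis B)
    show ?case
      using z
    proof (induction z rule: free_on_induct)
      case (basis C)
      obtain n m l where "A \<in> SP n" "B \<in> SP m" "C \<in> SP l"
        using \<open>A \<in> SP_all\<close> \<open>B \<in> SP_all\<close> \<open>C \<in> SP_all\<close> by (elim SP_allE)
      then show ?case
        \<comment> \<open>Both sides vanish unless all three degrees agree; in that case the claim
          is associativity of the join.\<close>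
        by (cases "m = n"; cases "l = m")
          (simp_all add: G0_prod_basis[of _ n _ n] G0_prod_basis[of _ n _ m]
            G0_prod_basis[of _ n _ l] G0_prod_basis[of _ m _ l] G0_prod_simps sp_join_SP sp_join_assoc)
    qed (simp_all add: G0_prod_simps)
  qed (simp_all add: G0_prod_simps)
qed (simp_all add: G0_prod_simps)

text \<open>This is the bijection behind compatibility. The degree of the left join recovers the
  place, where the cuts of \<open>A\<close> and \<open>B\<close> are unique. Conversely, a cut of
  \<open>A \<or> B\<close> puts \<open>A\<close> and \<open>B\<close> below the same
  \<open>1|1\<close>, so both are cut there.\<close>

lemma bij_betw_sp_cuts_join:
  assumes A: "A \<in> SP n" and B: "B \<in> SP n"
  shows "bij_betw
    (\<lambda>((A1, A2), (B1, B2)). (sp_join (sp_degree A1) A1 B1, sp_join (sp_degree A2) A2 B2))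
    {((A1, A2), (B1, B2)). (A1, A2) \<in> sp_cuts A \<and> (B1, B2) \<in> sp_cuts B \<and>
       sp_degree A1 = sp_degree B1 \<and> sp_degree A2 = sp_degree B2}
    (sp_cuts (sp_join n A B))" (is "bij_betw ?J ?M _")
proof -
  have M: "((A1, A2), (B1, B2)) \<in> ?M \<longleftrightarrow>
      (\<exists>k\<le>n. A1 \<in> SP k \<and> A2 \<in> SP (n - k) \<and> sp_bar k A1 A2 = A \<and>
              B1 \<in> SP k \<and> B2 \<in> SP (n - k) \<and> sp_bar k B1 B2 = B)" for A1 A2 B1 B2
    using sp_cuts_iff[OF A] sp_cuts_iff[OF B] by auto
  have "inj_on ?J ?M"
  proof (rule inj_onI)
    fix p q assume p: "p \<in> ?M" and q: "q \<in> ?M" and J: "?J p = ?J q"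
    obtain A1 A2 B1 B2 where p_eq: "p = ((A1, A2), (B1, B2))"
      by (metis surj_pair)
    obtain A1' A2' B1' B2' where q_eq: "q = ((A1', A2'), (B1', B2'))"
      by (metis surj_pair)
    obtain k where k: "k \<le> n"
      "A1 \<in> SP k" "A2 \<in> SP (n - k)" "sp_bar k A1 A2 = A"
      "B1 \<in> SP k" "B2 \<in> SP (n - k)" "sp_bar k B1 B2 = B"
      using p M unfolding p_eq by blast
    obtain k' where k': "k' \<le> n"
      "A1' \<in> SP k'" "A2' \<in> SP (n - k')" "sp_bar k' A1' A2' = A"
      "B1' \<in> SP k'" "B2' \<in> SP (n - k')" "sp_bar k' B1' B2' = B"
      using q M unfolding q_eq by blast
    have "sp_join (sp_degree A1) A1 B1 = sp_join (sp_degree A1') A1' B1'"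
      using J by (simp add: p_eq q_eq)
    then have "sp_join k A1 B1 = sp_join k' A1' B1'"
      using k k' by simp
    \<comment> \<open>Joining preserves the degree, so equal left joins come from cuts at the same
      place.\<close>
    then have "k = k'"
      using k k' by (metis sp_degree_SP sp_join_SP)
    then have "A1 = A1' \<and> A2 = A2'" "B1 = B1' \<and> B2 = B2'"
      using k k' sp_bar_eq_iff[of A1 k A1' A2 "n - k" A2'] sp_bar_eq_iff[of B1 k B1' B2 "n - k" B2']
      by simp_all
    then show "p = q"
      by (simp add: p_eq q_eq)
  qed
  moreover have "?J ` ?M = sp_cuts (sp_join n A B)"
  proof
    show "?J ` ?M \<subseteq> sp_cuts (sp_join n A B)"
    proof clarify
      fix A1 A2 B1 B2
      assume "(A1, A2) \<in> sp_cuts A" "(B1, B2) \<in> sp_cuts B"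
        "sp_degree A1 = sp_degree B1" "sp_degree A2 = sp_degree B2"
      then obtain k where k: "k \<le> n"
        "A1 \<in> SP k" "A2 \<in> SP (n - k)" "sp_bar k A1 A2 = A"
        "B1 \<in> SP k" "B2 \<in> SP (n - k)" "sp_bar k B1 B2 = B"
        using M[of A1 A2 B1 B2] by auto
      then have "sp_bar k (sp_join k A1 B1) (sp_join (n - k) A2 B2) = sp_join n A B"
        using sp_join_bar[of A1 k B1 A2 "n - k" B2] by simp
      then show "(sp_join (sp_degree A1) A1 B1, sp_join (sp_degree A2) A2 B2) \<in> sp_cuts (sp_join n A B)"
        using k by (auto simp: sp_cuts_iff[OF sp_join_SP[OF A B]] sp_join_SP)
    qed
    show "sp_cuts (sp_join n A B) \<subseteq> ?J ` ?M"
    proof (rule subrelI)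
      fix X Y assume "(X, Y) \<in> sp_cuts (sp_join n A B)"
      then obtain k where k: "k \<le> n" "X \<in> SP k" "Y \<in> SP (n - k)" "sp_bar k X Y = sp_join n A B"
        by (auto simp: sp_cuts_iff[OF sp_join_SP[OF A B]])
      have "sp_le (k + (n - k)) (sp_bar k X Y) (sp_bar k (sp_top k) (sp_top (n - k)))"
        using k(2,3) by (simp only: sp_bar_le_iff sp_top_SP sp_le_top simp_thms)
      then have "sp_le n (sp_join n A B) (sp_bar k (sp_top k) (sp_top (n - k)))"
        using k by simp
      then have le: "sp_le (k + (n - k)) A (sp_bar k (sp_top k) (sp_top (n - k)))"
        "sp_le (k + (n - k)) B (sp_bar k (sp_top k) (sp_top (n - k)))"
        using A B k(1) by (simp_all add: sp_join_le_iff)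
      obtain A1 A2 where A12: "A1 \<in> SP k" "A2 \<in> SP (n - k)" "A = sp_bar k A1 A2"
        using le(1) by (rule sp_le_bar_topE)
      obtain B1 B2 where B12: "B1 \<in> SP k" "B2 \<in> SP (n - k)" "B = sp_bar k B1 B2"
        using le(2) by (rule sp_le_bar_topE)
      \<comment> \<open>Both sides are cuts of \<open>A \<or> B\<close> at \<open>k\<close>, so
        their pieces agree.\<close>
      have "sp_bar k X Y = sp_bar k (sp_join k A1 B1) (sp_join (n - k) A2 B2)"
        using sp_join_bar[OF A12(1) B12(1) A12(2) B12(2)] A12(3) B12(3) k by simp
      then have "X = sp_join k A1 B1" "Y = sp_join (n - k) A2 B2"
        using k A12 B12 by (simp_all add: sp_bar_eq_iff sp_join_SP)
      moreover have "((A1, A2), (B1, B2)) \<in> ?M"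
        unfolding M using A12 B12 k(1) by auto
      ultimately show "(X, Y) \<in> ?J ` ?M"
        using A12 B12 by (intro image_eqI[of _ _ "((A1, A2), (B1, B2))"]) simp_all
    qed
  qed
  ultimately show ?thesis
    by (rule bij_betw_imageI)
qed

lemma G0_coprod_prod_basis:
  assumes A: "A \<in> SP n" and B: "B \<in> SP m"
  shows "G0_coprod (G0_prod (basis A) (basis B)) =
    tens_mult G0_prod (G0_coprod (basis A)) (G0_coprod (basis B) :: _ \<Rightarrow>\<^sub>0 'k::field)"
proof -
  define J where "J = (\<lambda>((A1, A2), (B1, B2)).
    (sp_join (sp_degree A1) A1 B1, sp_join (sp_degree A2) A2 B2))"
  define M where "M = {((A1, A2), (B1, B2)). (A1, A2) \<in> sp_cuts A \<and> (B1, B2) \<in> sp_cuts B \<and>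
       sp_degree A1 = sp_degree B1 \<and> sp_degree A2 = sp_degree B2}"
  define T :: "_ \<Rightarrow> _ \<Rightarrow> (nat set set \<times> nat set set \<Rightarrow>\<^sub>0 'k)" where
    "T p q = tens (G0_prod (basis (fst p)) (basis (fst q))) (G0_prod (basis (snd p)) (basis (snd q)))" for p q
  have all: "A \<in> SP_all" "B \<in> SP_all"
    using A B SP_subset_SP_all by blast+
  \<comment> \<open>If the degrees of the left or of the right pieces differ, one tensor factor is
    zero. Only the pairs in \<open>M\<close> survive, and \<open>J\<close> reindexes them by the
    cuts of the join.\<close>
  have T: "T p q = (if (p, q) \<in> M then basis (J (p, q)) else 0)"
    if "p \<in> sp_cuts A" "q \<in> sp_cuts B" for p q
  proof -
    obtain A1 A2 k where p: "p = (A1, A2)" "A1 \<in> SP k" "A2 \<in> SP (n - k)"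
      using \<open>p \<in> sp_cuts A\<close> sp_cuts_iff[OF A] by (cases p) auto
    obtain B1 B2 l where q: "q = (B1, B2)" "B1 \<in> SP l" "B2 \<in> SP (m - l)"
      using \<open>q \<in> sp_cuts B\<close> sp_cuts_iff[OF B] by (cases q) auto
    show ?thesis
      using p q that by (auto simp: T_def M_def J_def G0_prod_basis tens_simps)
  qed
  have "tens_mult G0_prod (G0_coprod (basis A)) (G0_coprod (basis B) :: _ \<Rightarrow>\<^sub>0 'k) =
      (\<Sum>p\<in>sp_cuts A. \<Sum>q\<in>sp_cuts B. T p q)"
    using all by (simp add: G0_coprod_basis tens_mult_def bilin_ext_sum T_def case_prod_unfold)
  also have "\<dots> = (\<Sum>(p, q)\<in>sp_cuts A \<times> sp_cuts B. T p q)"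
    by (simp add: sum.cartesian_product)
  also have "\<dots> = (\<Sum>r\<in>M. basis (J r))"
  proof (rule sum.mono_neutral_cong_right)
    show "finite (sp_cuts A \<times> sp_cuts B)"
      using all by simp
    show M: "M \<subseteq> sp_cuts A \<times> sp_cuts B"
      by (auto simp: M_def)
    show "\<forall>r\<in>sp_cuts A \<times> sp_cuts B - M. (case r of (p, q) \<Rightarrow> T p q) = 0"
      using T by auto
    show "(case r of (p, q) \<Rightarrow> T p q) = basis (J r)" if "r \<in> M" for r
      using that M T by (cases r) auto
  qed
  also have "\<dots> = G0_coprod (G0_prod (basis A) (basis B))"
  proof (cases "m = n")
    case True
    with A B bij_betw_sp_cuts_join[of A n B]
    have "bij_betw J M (sp_cuts (sp_join n A B))"
      by (simp add: J_def M_def)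
    moreover have "sp_join n A B \<in> SP_all"
      using A B True by (auto intro: SP_subset_SP_all[of _ n] sp_join_SP)
    ultimately show ?thesis
      using A B True by (simp add: G0_prod_basis G0_coprod_basis sum.reindex_bij_betw[of J M _ basis])
  next
    case False
    \<comment> \<open>Degrees of the two pieces add up to the degree of the whole, so a matching
      pair would force \<open>n = m\<close>.\<close>
    have "M = {}"
    proof -
      have "n = m" if "(A1, A2) \<in> sp_cuts A" "(B1, B2) \<in> sp_cuts B"
        "sp_degree A1 = sp_degree B1" "sp_degree A2 = sp_degree B2" for A1 A2 B1 B2
      proof -
        have "n = sp_degree A1 + sp_degree A2" "m = sp_degree B1 + sp_degree B2"
          using that sp_cuts_iff[OF A] sp_cuts_iff[OF B] by auto
        with that show ?thesis
          by simp
      qed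
      with False show ?thesis
        by (auto simp: M_def)
    qed
    with A B False show ?thesis
      by (simp add: G0_prod_basis G0_coprod_simps)
  qed
  finally show ?thesis
    by simp
qed

lemma G0_coprod_prod:
  assumes "x \<in> free_on SP_all" and y: "y \<in> free_on SP_all"
  shows "G0_coprod (G0_prod x y) = tens_mult G0_prod (G0_coprod x) (G0_coprod y)"
  using assms(1)
proof (induction x rule: free_on_induct)
  case (basis A)
  show ?case
    using y
  proof (induction y rule: free_on_induct)
    case (basis B)
    obtain n m where "A \<in> SP n" "B \<in> SP m"
      using \<open>A \<in> SP_all\<close> \<open>B \<in> SP_all\<close> by (elim SP_allE)
    then show ?case
      by (rule G0_coprod_prod_basis)
  qed (simp_all add: G0_prod_simps G0_coprod_simps tens_mult_simps)
qed (simp_all add: G0_prod_simps G0_coprod_simps tens_mult_simps)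

section \<open>Coassociativity and counit\<close>

lemma sp_bar_SP_all:
  assumes "B \<in> SP_all" "C \<in> SP_all"
  shows "sp_bar (sp_degree B) B C \<in> SP_all" "sp_degree (sp_bar (sp_degree B) B C) = sp_degree B + sp_degree C"
proof -
  obtain k l where "B \<in> SP k" "C \<in> SP l"
    using assms by (elim SP_allE)
  then have "sp_bar (sp_degree B) B C \<in> SP (k + l)" "sp_degree B = k" "sp_degree C = l"
    by simp_all
  then show "sp_bar (sp_degree B) B C \<in> SP_all" "sp_degree (sp_bar (sp_degree B) B C) = sp_degree B + sp_degree C"
    by (auto intro: SP_subset_SP_all)
qed

text \<open>Both iterated coproducts run over the ways to cut \<open>A\<close> into three
  consecutive pieces. The sides record them as \<open>(P|Q)|R\<close> and as
  \<open>P|(Q|R)\<close>.\<close>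

lemma coassoc_basis:
  assumes A: "A \<in> SP_all"
  shows "tens_assoc (map_tens G0_coprod id (G0_coprod (basis A)))
    = map_tens id G0_coprod (G0_coprod (basis A) :: _ \<Rightarrow>\<^sub>0 'k::field)"
proof -
  have cut: "fst p \<in> SP_all" "snd p \<in> SP_all" if "p \<in> sp_cuts A" for p
    using that by (auto simp: sp_cuts_def)
  \<comment> \<open>An index is a cut of \<open>A\<close> followed by a cut of one of its pieces.
    \<open>i\<close> and \<open>j\<close> rebracket; the ignored \<open>E\<close> is the piece that
    is cut again, hence determined by the inner cut.\<close>
  define i :: "(nat set set \<times> nat set set) \<times> nat set set \<times> nat set set \<Rightarrow> _"
    where "i = (\<lambda>((P, E), (Q, R)). ((sp_bar (sp_degree P) P Q, R), (P, Q)))"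
  define j :: "(nat set set \<times> nat set set) \<times> nat set set \<times> nat set set \<Rightarrow> _"
    where "j = (\<lambda>((E, R), (P, Q)). ((P, sp_bar (sp_degree Q) Q R), (Q, R)))"
  have "tens_assoc (map_tens G0_coprod id (G0_coprod (basis A) :: _ \<Rightarrow>\<^sub>0 'k))
      = (\<Sum>p\<in>sp_cuts A. \<Sum>q\<in>sp_cuts (fst p). basis (fst q, snd q, snd p))"
    using A cut
    by (simp add: G0_coprod_basis linear_on_sum[OF linear_tens_ops(3)] linear_on_sum[OF linear_tens_ops(4)])
      (simp add: map_tens_def case_prod_unfold G0_coprod_basis linear_on_sum[OF linear_tens_ops(1)]
        lin_ext_sum tens_assoc_def)
  also have "\<dots> = (\<Sum>(p, q)\<in>Sigma (sp_cuts A) (\<lambda>p. sp_cuts (fst p)). basis (fst q, snd q, snd p))"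
    using A cut by (subst sum.Sigma) auto
  also have "\<dots> = (\<Sum>(p, q)\<in>Sigma (sp_cuts A) (\<lambda>p. sp_cuts (snd p)). basis (fst p, fst q, snd q))"
  proof (rule sum.reindex_bij_witness[where i = i and j = j])
    fix r assume "r \<in> Sigma (sp_cuts A) (\<lambda>p. sp_cuts (fst p))"
    then obtain P Q R where r: "r = ((sp_bar (sp_degree P) P Q, R), (P, Q))"
      and all: "P \<in> SP_all" "Q \<in> SP_all" "R \<in> SP_all"
      and A_eq: "sp_bar (sp_degree P + sp_degree Q) (sp_bar (sp_degree P) P Q) R = A"
      by (auto simp: sp_cuts_def sp_bar_SP_all)
    show "i (j r) = r"
      by (simp add: r i_def j_def)
    show "j r \<in> Sigma (sp_cuts A) (\<lambda>p. sp_cuts (snd p))"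
      using all A_eq by (simp add: r j_def sp_cuts_def sp_bar_SP_all sp_bar_assoc)
    show "(case j r of (p, q) \<Rightarrow> basis (fst p, fst q, snd q)) =
        (case r of (p, q) \<Rightarrow> basis (fst q, snd q, snd p))"
      by (simp add: r j_def)
  next
    fix r assume "r \<in> Sigma (sp_cuts A) (\<lambda>p. sp_cuts (snd p))"
    then obtain P Q R where r: "r = ((P, sp_bar (sp_degree Q) Q R), (Q, R))"
      and all: "P \<in> SP_all" "Q \<in> SP_all" "R \<in> SP_all"
      and A_eq: "sp_bar (sp_degree P) P (sp_bar (sp_degree Q) Q R) = A"
      by (auto simp: sp_cuts_def)
    show "j (i r) = r"
      by (simp add: r i_def j_def)
    show "i r \<in> Sigma (sp_cuts A) (\<lambda>p. sp_cuts (fst p))"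
      using all A_eq by (simp add: r i_def sp_cuts_def sp_bar_SP_all sp_bar_assoc)
  qed
  also have "\<dots> = (\<Sum>p\<in>sp_cuts A. \<Sum>q\<in>sp_cuts (snd p). basis (fst p, fst q, snd q))"
    using A cut by (subst sum.Sigma) auto
  also have "\<dots> = map_tens id G0_coprod (G0_coprod (basis A) :: _ \<Rightarrow>\<^sub>0 'k)"
    using A cut
    by (simp add: G0_coprod_basis linear_on_sum[OF linear_tens_ops(3)])
      (simp add: map_tens_def case_prod_unfold G0_coprod_basis linear_on_sum[OF linear_tens_ops(2)])
  finally show ?thesis .
qed

text \<open>The form is nonzero only on the empty partition, and exactly one cut of \<open>A\<close>
  has the empty partition on the given side.\<close>

lemma counit_basis:
  fixes A :: "nat set set"
  assumes A: "A \<in> SP_all"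
  defines "e \<equiv> \<lambda>B :: nat set set. if B = {} then 1 else 0 :: 'k::field"
  shows "lin_ext (\<lambda>(a, b). scl (e a) (basis b)) (G0_coprod (basis A)) = basis A"
    and "lin_ext (\<lambda>(a, b). scl (e b) (basis a)) (G0_coprod (basis A)) = basis A"
proof -
  have [simp]: "sp_degree {} = 0" "{} \<in> SP_all"
    by (auto simp: sp_degree_def intro: SP_subset_SP_all[of _ 0])
  have cut: "({}, C) \<in> sp_cuts A \<longleftrightarrow> C = A" "(C, {}) \<in> sp_cuts A \<longleftrightarrow> C = A" for C
    using A by (auto simp: sp_cuts_def)
  have "(\<Sum>p\<in>sp_cuts A. scl (e (fst p)) (basis (snd p))) = (\<Sum>p\<in>{({}, A)}. scl (e (fst p)) (basis (snd p)))"
    using A cut by (intro sum.mono_neutral_right) (auto simp: e_def)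
  then show "lin_ext (\<lambda>(a, b). scl (e a) (basis b)) (G0_coprod (basis A)) = basis A"
    using A by (simp add: G0_coprod_basis lin_ext_sum case_prod_unfold e_def)
  have "(\<Sum>p\<in>sp_cuts A. scl (e (snd p)) (basis (fst p))) = (\<Sum>p\<in>{(A, {})}. scl (e (snd p)) (basis (fst p)))"
    using A cut by (intro sum.mono_neutral_right) (auto simp: e_def)
  then show "lin_ext (\<lambda>(a, b). scl (e b) (basis a)) (G0_coprod (basis A)) = basis A"
    using A by (simp add: G0_coprod_basis lin_ext_sum case_prod_unfold e_def)
qed

lemma coassoc_coalgebra_G0:
  "coassoc_coalgebra SP_all (G0_coprod :: (_ \<Rightarrow>\<^sub>0 'k::field) \<Rightarrow> _) (\<lambda>B. if B = {} then 1 else 0)"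
  unfolding coassoc_coalgebra_def
proof (intro conjI ballI)
  fix x :: "nat set set \<Rightarrow>\<^sub>0 'k" assume x: "x \<in> free_on SP_all"
  show "G0_coprod x \<in> free_on (SP_all \<times> SP_all)"
    using x
  proof (induction x rule: free_on_induct)
    case (basis A)
    then show ?case
      unfolding G0_coprod_basis[OF basis] by (intro free_on_sum free_on_intros) (auto simp: sp_cuts_def)
  qed (auto simp: G0_coprod_simps)
  show "tens_assoc (map_tens G0_coprod id (G0_coprod x)) = map_tens id G0_coprod (G0_coprod x)"
    using x by (induction x rule: free_on_induct)
      (simp_all only: G0_coprod_simps map_tens_simps tens_assoc_simps coassoc_basis)
  show "lin_ext (\<lambda>(a, b). scl (if a = {} then 1 else 0) (basis b)) (G0_coprod x) = x"
    using x by (induction x rule: free_on_induct)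
      (simp_all only: G0_coprod_simps lin_ext_zero lin_ext_add lin_ext_scl counit_basis)
  show "lin_ext (\<lambda>(a, b). scl (if b = {} then 1 else 0) (basis a)) (G0_coprod x) = x"
    using x by (induction x rule: free_on_induct)
      (simp_all only: G0_coprod_simps lin_ext_zero lin_ext_add lin_ext_scl counit_basis)
qed (simp add: linear_on_def G0_coprod_simps)

text \<open>Only degree \<open>0\<close> contains the empty partition, and joining preserves degree.
  On basis elements of different degrees both sides are zero.\<close>

lemma counit_prod:
  assumes "x \<in> free_on SP_all" and y: "y \<in> free_on SP_all"
  defines "e \<equiv> lin_form (\<lambda>B. if B = {} then 1 else 0)"
  shows "e (G0_prod x y) = e x * e y"
  using assms(1)
proof (induction x rule: free_on_induct)
  case (basis A)
  show ?case
    using y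
  proof (induction y rule: free_on_induct)
    case (basis B)
    obtain n m where "A \<in> SP n" "B \<in> SP m"
      using \<open>A \<in> SP_all\<close> \<open>B \<in> SP_all\<close> by (elim SP_allE)
    then show ?case
      using sp_join_SP[of A n B] SP_empty_iff[of A n] SP_empty_iff[of B m] SP_empty_iff[of "sp_join n A B" n]
      by (auto simp: G0_prod_basis e_def)
  qed (simp_all add: G0_prod_simps e_def algebra_simps)
qed (simp_all add: G0_prod_simps e_def algebra_simps)

text \<open>Singletons can be cut at every place, each time into two partitions into singletons, and
  at each place the cut is unique.\<close>

lemma G0_coprod_bot:
  "G0_coprod (basis (sp_bot n)) = (\<Sum>k\<le>n. tens (basis (sp_bot k)) (basis (sp_bot (n - k))))"
proof -
  have "(B, C) \<in> sp_cuts (sp_bot n) \<longleftrightarrow> (\<exists>k\<le>n. B = sp_bot k \<and> C = sp_bot (n - k))" for B C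
  proof -
    have "B \<in> SP k \<and> C \<in> SP (n - k) \<and> sp_bar k B C = sp_bot n \<longleftrightarrow> B = sp_bot k \<and> C = sp_bot (n - k)"
      if "k \<le> n" for k
      using that sp_bar_bot[of k "n - k"] sp_bar_eq_iff[of B k "sp_bot k" C "n - k" "sp_bot (n - k)"]
      by auto
    then show ?thesis
      unfolding sp_cuts_iff[OF sp_bot_SP] by (simp cong: conj_cong)
  qed
  then have cuts: "sp_cuts (sp_bot n) = (\<lambda>k. (sp_bot k, sp_bot (n - k))) ` {..n}"
    by auto
  have "inj_on (\<lambda>k. (sp_bot k, sp_bot (n - k))) {..n}"
    by (rule inj_onI) (metis fst_conv sp_bot_SP sp_degree_SP)
  then show ?thesis
    by (simp add: G0_coprod_basis SP_subset_SP_all[OF sp_bot_SP] cuts sum.reindex)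
qed

lemma formal_unit_G0: "formal_unit sp_degree SP_all G0_prod (\<lambda>n. basis (sp_bot n))"
proof -
  have deg: "{A \<in> SP_all. sp_degree A = n} = SP n" for n
    by (auto simp: SP_all_iff)
  have "G0_prod (basis (sp_bot p)) x = (if p = n then x else 0) \<and>
      G0_prod x (basis (sp_bot p)) = (if p = n then x else 0)"
    if "x \<in> free_on (SP n)" for n p and x :: "nat set set \<Rightarrow>\<^sub>0 'a"
    using that
  proof (induction x rule: free_on_induct)
    case (basis A)
    then show ?case
      by (simp add: G0_prod_basis[of _ p _ n] G0_prod_basis[of _ n _ p] sp_join_bot)
  qed (auto simp: G0_prod_simps)
  then show ?thesis
    unfolding formal_unit_def deg by auto
qed

theorem proposition2p4:
  shows "bialgebra sp_degree SP_all
           (G0_prod :: (nat set set \<Rightarrow>\<^sub>0 'k::field_char_0) \<Rightarrow> (nat set set \<Rightarrow>\<^sub>0 'k) \<Rightarrow> (nat set set \<Rightarrow>\<^sub>0 'k))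
           G0_coprod"
  unfolding bialgebra_def
proof (intro conjI)
  show "assoc_algebra SP_all (G0_prod :: (_ \<Rightarrow>\<^sub>0 'k) \<Rightarrow> _)"
    by (simp add: assoc_algebra_def G0_prod_closed G0_prod_assoc linear_on_def G0_prod_simps)
  show "\<forall>x\<in>free_on SP_all. \<forall>y\<in>free_on SP_all.
      G0_coprod (G0_prod x y) = tens_mult G0_prod (G0_coprod x) (G0_coprod y :: _ \<Rightarrow>\<^sub>0 'k)"
    by (simp add: G0_coprod_prod)
  show "\<exists>e. coassoc_coalgebra SP_all (G0_coprod :: (_ \<Rightarrow>\<^sub>0 'k) \<Rightarrow> _) e \<and>
      (\<forall>x\<in>free_on SP_all. \<forall>y\<in>free_on SP_all. lin_form e (G0_prod x y) = lin_form e x * lin_form e y) \<and>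
      (\<exists>u. formal_unit sp_degree SP_all G0_prod u \<and>
        (\<forall>n. G0_coprod (u n) = (\<Sum>k\<le>n. tens (u k) (u (n - k)))) \<and>
        (\<forall>n. lin_form e (u n) = (if n = 0 then 1 else 0)))"
  \<comment> \<open>The empty partition is the only one of degree \<open>0\<close>, so the counit
    detecting that degree can be written as a test for \<open>{}\<close>.\<close>
  proof (intro exI[of _ "\<lambda>B. if B = {} then 1 else 0"] exI[of _ "\<lambda>n. basis (sp_bot n)"] conjI)
    show "\<forall>n. lin_form (\<lambda>B. if B = {} then 1 else 0) (basis (sp_bot n)) = (if n = 0 then 1 else (0 :: 'k))"
      by (simp add: SP_empty_iff[OF sp_bot_SP])
  qed (simp_all add: coassoc_coalgebra_G0 counit_prod formal_unit_G0 G0_coprod_bot)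
qed

end
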